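(* Let $\mathrm{R}$ be a complex $3$-dimensional right alternative algebra with nonzero multiplication. Then either $\mathrm{R}$ is commutative and isomorphic to one of the commutative associative algebras $\mathrm{A}_{01},\dots,\mathrm{A}_{11}$ listed in the context, or $\mathrm{R}$ is isomorphic to one of the following algebras (given in a basis $e_1,e_2,e_3$; all products of basis elements not listed are zero): $\mathrm{R}_{00}$: $e_1e_2=e_3$, $e_2e_1=-e_3$; $\mathrm{R}_{01}$: $e_1e_1=e_2$, $e_1e_3=e_2$, $e_3e_1=-e_2$; $\mathrm{R}_{02}^{\alpha}$ ($\alpha\in\mathbb{C}$, $\alpha\neq 0$): $e_1e_2=(1+\alpha)e_3$, $e_2e_1=(1-\alpha)e_3$; $\mathrm{R}_{03}$: $e_1e_1=e_1$, $e_1e_2=e_2$, $e_1e_3=e_3$, $e_3e_1=e_3$; $\mathrm{R}_{04}$: $e_1e_1=e_1$, $e_1e_2=e_2+e_3$, $e_1e_3=e_3$, $e_2e_1=-e_3$, $e_3e_1=e_3$; $\mathrm{R}_{05}$: $e_1e_1=e_1$, $e_1e_3=e_3$, $e_2e_1=e_2$, $e_3e_1=e_3$; $\mathrm{R}_{06}$: $e_1e_1=e_1$, $e_1e_2=e_2$, $e_1e_3=e_3$; $\mathrm{R}_{07}$: $e_1e_1=e_1$, $e_2e_1=e_2$, $e_3e_1=e_3$; $\mathrm{R}_{08}$: $e_1e_1=e_1$, $e_1e_3=e_3$, $e_2e_1=e_2$; $\mathrm{R}_{09}$: $e_1e_1=e_1$, $e_2e_1=e_2$, $e_2e_2=e_3$;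 $\mathrm{R}_{10}$: $e_1e_1=e_1$, $e_1e_2=e_2$, $e_1e_3=e_3$, $e_2e_2=e_3$, $e_3e_1=e_3$; $\mathrm{R}_{11}$: $e_1e_1=e_1$, $e_1e_3=e_3$, $e_2e_2=e_2$, $e_3e_2=e_3$; $\mathrm{R}_{12}$: $e_1e_1=e_1$, $e_2e_1=e_2$; $\mathrm{R}_{13}$: $e_1e_1=e_1$, $e_1e_2=e_3$, $e_2e_1=e_2-e_3$; $\mathrm{R}_{14}$: $e_1e_1=e_1$, $e_1e_2=e_2$; $\mathrm{R}_{15}$: $e_1e_1=e_1$, $e_1e_3=e_3$, $e_2e_2=e_2$; $\mathrm{R}_{16}$: $e_1e_1=e_1$, $e_2e_2=e_2$, $e_3e_1=e_3$. All listed algebras are pairwise non-isomorphic, except that $\mathrm{R}_{02}^{\alpha}\cong \mathrm{R}_{02}^{-\alpha}$.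
   Context: An algebra is a complex vector space with a bilinear (not necessarily associative) multiplication; the associator is $(x,y,z)=(xy)z-x(yz)$. An algebra is right alternative if $(x,y,z)=-(x,z,y)$ for all $x,y,z$. The commutative algebras $\mathrm{A}_{01},\dots,\mathrm{A}_{11}$ are given in a basis $e_1,e_2,e_3$; the multiplication is commutative ($e_ie_j=e_je_i$), and products neither listed nor obtained from listed ones by commutativity are zero: $\mathrm{A}_{01}$: $e_1e_1=e_1$, $e_2e_2=e_2$; $\mathrm{A}_{02}$: $e_1e_1=e_1$, $e_1e_2=e_2$; $\mathrm{A}_{03}$: $e_1e_1=e_1$; $\mathrm{A}_{04}$: $e_1e_1=e_2$; $\mathrm{A}_{05}$: $e_1e_2=e_3$; $\mathrm{A}_{06}$: $e_1e_1=e_2$, $e_1e_2=e_3$; $\mathrm{A}_{07}$: $e_1e_1=e_1$, $e_2e_2=e_2$, $e_3e_3=e_3$; $\mathrm{A}_{08}$: $e_1e_1=e_1$, $e_2e_2=e_2$, $e_2e_3=e_3$; $\mathrm{A}_{09}$: $e_1e_1=e_1$, $e_1e_2=e_2$, $e_1e_3=e_3$; $\mathrm{A}_{10}$: $e_1e_1=e_1$, $e_1e_2=e_2$, $e_1e_3=e_3$, $e_2e_2=e_3$; $\mathrm{A}_{11}$: $e_1e_1=e_1$, $e_2e_2=e_3$. *)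

theory Defs
  imports "HOL-Analysis.Analysis"
begin

locale complex_algebra = vector_space scl
  for scl :: "complex \<Rightarrow> 'a::ab_group_add \<Rightarrow> 'a" +
  fixes mul :: "'a \<Rightarrow> 'a \<Rightarrow> 'a"
  assumes linear_mult_left: "Vector_Spaces.linear scl scl (\<lambda>x. mul x y)"
    and linear_mult_right: "Vector_Spaces.linear scl scl (\<lambda>y. mul x y)"

definition associator :: "('a::ab_group_add \<Rightarrow> 'a \<Rightarrow> 'a) \<Rightarrow> 'a \<Rightarrow> 'a \<Rightarrow> 'a \<Rightarrow> 'a" where
  "associator mul x y z = mul (mul x y) z - mul x (mul y z)"

definition right_alternative :: "('a::ab_group_add \<Rightarrow> 'a \<Rightarrow> 'a) \<Rightarrow> bool" where
  "right_alternative mul \<longleftrightarrow> (\<forall>x y z. associator mul x y z = - associator mul x z y)"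

definition associative :: "('a::ab_group_add \<Rightarrow> 'a \<Rightarrow> 'a) \<Rightarrow> bool" where
  "associative mul \<longleftrightarrow> (\<forall>x y z. associator mul x y z = 0)"

definition commutative :: "('a \<Rightarrow> 'a \<Rightarrow> 'a) \<Rightarrow> bool" where
  "commutative mul \<longleftrightarrow> (\<forall>x y. mul x y = mul y x)"

definition algebra_isomorphic ::
  "(complex \<Rightarrow> 'a::ab_group_add \<Rightarrow> 'a) \<Rightarrow> ('a \<Rightarrow> 'a \<Rightarrow> 'a) \<Rightarrow>
   (complex \<Rightarrow> 'b::ab_group_add \<Rightarrow> 'b) \<Rightarrow> ('b \<Rightarrow> 'b \<Rightarrow> 'b) \<Rightarrow> bool" where
  "algebra_isomorphic scl mul scl' mul' \<longleftrightarrow>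
     (\<exists>f. Vector_Spaces.linear scl scl' f \<and> bij f \<and>
          (\<forall>x y. f (mul x y) = mul' (f x) (f y)))"

text \<open>The listed algebras live on \<^typ>\<open>complex^3\<close> with its standard basis. A multiplication table
  lists products of basis vectors, an entry \<open>((i, j), v)\<close> meaning that the \<open>i\<close>-th times the \<open>j\<close>-th
  basis vector is \<open>v\<close>; products not in the table are zero.\<close>

abbreviation (input) e1 :: "complex^3" where "e1 \<equiv> axis 1 1"
abbreviation (input) e2 :: "complex^3" where "e2 \<equiv> axis 2 1"
abbreviation (input) e3 :: "complex^3" where "e3 \<equiv> axis 3 1"

type_synonym mult_table = "((3 \<times> 3) \<times> (complex^3)) list"

definition basis_product :: "mult_table \<Rightarrow> 3 \<Rightarrow> 3 \<Rightarrow> complex^3" where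
  "basis_product t i j = (case map_of t (i, j) of None \<Rightarrow> 0 | Some v \<Rightarrow> v)"

definition table_mult :: "mult_table \<Rightarrow> complex^3 \<Rightarrow> complex^3 \<Rightarrow> complex^3" where
  "table_mult t x y = (\<Sum>i\<in>UNIV. \<Sum>j\<in>UNIV. (x $ i * y $ j) *s basis_product t i j)"

definition comm_table :: "mult_table \<Rightarrow> mult_table" where
  "comm_table t = t @ map (\<lambda>((i, j), v). ((j, i), v)) t"

datatype alg_name =
    A01 | A02 | A03 | A04 | A05 | A06 | A07 | A08 | A09 | A10 | A11
  | R00 | R01 | R02 complex | R03 | R04 | R05 | R06 | R07 | R08
  | R09 | R10 | R11 | R12 | R13 | R14 | R15 | R16

fun alg_table :: "alg_name \<Rightarrow> mult_table" where
  "alg_table A01 = comm_table [((1,1), e1), ((2,2), e2)]"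
| "alg_table A02 = comm_table [((1,1), e1), ((1,2), e2)]"
| "alg_table A03 = comm_table [((1,1), e1)]"
| "alg_table A04 = comm_table [((1,1), e2)]"
| "alg_table A05 = comm_table [((1,2), e3)]"
| "alg_table A06 = comm_table [((1,1), e2), ((1,2), e3)]"
| "alg_table A07 = comm_table [((1,1), e1), ((2,2), e2), ((3,3), e3)]"
| "alg_table A08 = comm_table [((1,1), e1), ((2,2), e2), ((2,3), e3)]"
| "alg_table A09 = comm_table [((1,1), e1), ((1,2), e2), ((1,3), e3)]"
| "alg_table A10 = comm_table [((1,1), e1), ((1,2), e2), ((1,3), e3), ((2,2), e3)]"
| "alg_table A11 = comm_table [((1,1), e1), ((2,2), e3)]"
| "alg_table R00 = [((1,2), e3), ((2,1), - e3)]"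
| "alg_table R01 = [((1,1), e2), ((1,3), e2), ((3,1), - e2)]"
| "alg_table (R02 \<alpha>) = [((1,2), (1 + \<alpha>) *s e3), ((2,1), (1 - \<alpha>) *s e3)]"
| "alg_table R03 = [((1,1), e1), ((1,2), e2), ((1,3), e3), ((3,1), e3)]"
| "alg_table R04 = [((1,1), e1), ((1,2), e2 + e3), ((1,3), e3), ((2,1), - e3), ((3,1), e3)]"
| "alg_table R05 = [((1,1), e1), ((1,3), e3), ((2,1), e2), ((3,1), e3)]"
| "alg_table R06 = [((1,1), e1), ((1,2), e2), ((1,3), e3)]"
| "alg_table R07 = [((1,1), e1), ((2,1), e2), ((3,1), e3)]"
| "alg_table R08 = [((1,1), e1), ((1,3), e3), ((2,1), e2)]"
| "alg_table R09 = [((1,1), e1), ((2,1), e2), ((2,2), e3)]"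
| "alg_table R10 = [((1,1), e1), ((1,2), e2), ((1,3), e3), ((2,2), e3), ((3,1), e3)]"
| "alg_table R11 = [((1,1), e1), ((1,3), e3), ((2,2), e2), ((3,2), e3)]"
| "alg_table R12 = [((1,1), e1), ((2,1), e2)]"
| "alg_table R13 = [((1,1), e1), ((1,2), e3), ((2,1), e2 - e3)]"
| "alg_table R14 = [((1,1), e1), ((1,2), e2)]"
| "alg_table R15 = [((1,1), e1), ((1,3), e3), ((2,2), e2)]"
| "alg_table R16 = [((1,1), e1), ((2,2), e2), ((3,1), e3)]"

definition alg_mult :: "alg_name \<Rightarrow> complex^3 \<Rightarrow> complex^3 \<Rightarrow> complex^3" where
  "alg_mult X = table_mult (alg_table X)"

definition A_list :: "alg_name set" where
  "A_list = {A01, A02, A03, A04, A05, A06, A07, A08, A09, A10, A11}"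

definition R_list :: "alg_name set" where
  "R_list = {R00, R01, R03, R04, R05, R06, R07, R08, R09, R10, R11, R12, R13, R14, R15, R16}
            \<union> {R02 \<alpha> | \<alpha>. \<alpha> \<noteq> 0}"

lemma table_mult_axis: "table_mult t (axis i 1) (axis j 1) = basis_product t i j"
proof -
  have "table_mult t (axis i 1) (axis j 1) =
      (\<Sum>k\<in>UNIV. \<Sum>l\<in>UNIV. if k = i then (if l = j then basis_product t k l else 0) else 0)"
    unfolding table_mult_def by (intro sum.cong) (auto simp: axis_def)
  also have "\<dots> = (\<Sum>k\<in>UNIV. if k = i then (\<Sum>l\<in>UNIV. if l = j then basis_product t k l else 0) else 0)"
    by (intro sum.cong) auto
  finally show ?thesis by simp
qed

lemma complex_algebra_table_mult: "complex_algebra (*s) (table_mult t)"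
proof unfold_locales
  show "table_mult t (x + x') y = table_mult t x y + table_mult t x' y" for x x' y
    by (simp add: table_mult_def algebra_simps sum.distrib vector_sadd_rdistrib)
  show "table_mult t (c *s x) y = c *s table_mult t x y" for c x y
    by (simp add: table_mult_def vec.scale_sum_right mult_ac)
  show "table_mult t x (y + y') = table_mult t x y + table_mult t x y'" for x y y'
    by (simp add: table_mult_def algebra_simps sum.distrib vector_sadd_rdistrib)
  show "table_mult t x (c *s y) = c *s table_mult t x y" for c x y
    by (simp add: table_mult_def vec.scale_sum_right mult_ac)
qed

end

(* If R has no nonzero idempotent, then every element is nilpotent, since the operator of right
   multiplication by a power of x is the power of the operator of right multiplication by x.  Then R
   is generated by one element, or has zero squares, or its product is a bilinear form in two
   variables with values in an annihilating line.

   An idempotent e yields a Peirce decomposition of R into the eigenspaces J_0, J_1, J_2 of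
   x |-> ex + xe for the eigenvalues 0, 1, 2, and the structure constants in an adapted basis are
   then almost determined.  If some idempotent has J_0 nonzero, this settles the matter.  The case
   dim J_2 = 2, dim J_1 = 1 and the unital case either contain such an idempotent or have only
   nilpotent elements in J_2 besides the multiples of e, up to adding multiples of e.

   The listed algebras are separated by a few isomorphism invariants, such as the existence of
   one-sided annihilators, of orthogonal idempotents or of active elements of square zero. *)
theory Submission
  imports Defs "HOL-Computational_Algebra.Fundamental_Theorem_Algebra"
begin

section \<open>Isomorphism invariants of the listed algebras\<close>

text \<open>Right alternativity treats the two sides of an idempotent \<open>e\<close> differently.
  Right multiplication by \<open>e\<close> is idempotent, since the associator (x, e, e) vanishes,
  but left multiplication need not be: in \<open>R13\<close> it sends \<open>e2\<close> to
  \<open>e3\<close> and \<open>e3\<close> to 0. For this reason the Peirce spaces are those of the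
  sum of the two multiplications. On \<open>J_0\<close> and \<open>J_2\<close> the eigenvalue
  determines each multiplication separately. On \<open>J_1\<close> it does not: for \<open>u\<close>
  in \<open>J_1\<close> the product \<open>u e\<close> may have components along \<open>J_0\<close>
  or \<open>J_2\<close>. The coefficients of these components run through the case analysis; they
  are killed by the identity, or absorbed by passing to another idempotent (\<open>R09\<close>,
  \<open>R10\<close>), or survive and give \<open>R04\<close> and \<open>R13\<close>.

  The parameter of \<open>R02\<close> compares the skew part of a bilinear form of rank 2 with its
  symmetric part. It is determined up to sign because the two isotropic lines can be interchanged;
  the value 0 would give \<open>A05\<close>, hence \<alpha> \<noteq> 0.\<close>

lemma all_vec3: "(\<forall>x::complex^3. P x) \<longleftrightarrow> (\<forall>a b c. P (vector [a, b, c]))"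
  by (metis forall_vector_3)

lemma ex_vec3: "(\<exists>x::complex^3. P x) \<longleftrightarrow> (\<exists>a b c. P (vector [a, b, c]))"
  using all_vec3[of "\<lambda>x. \<not> P x"] by blast

lemma vec3_simps:
  "vector [a, b, c] = (vector [a', b', c'] :: complex^3) \<longleftrightarrow> a = a' \<and> b = b' \<and> c = c'"
  "vector [a, b, c] = (0 :: complex^3) \<longleftrightarrow> a = 0 \<and> b = 0 \<and> c = 0"
  "vector [a, b, c] + (vector [a', b', c'] :: complex^3) = vector [a + a', b + b', c + c']"
  "vector [a, b, c] - (vector [a', b', c'] :: complex^3) = vector [a - a', b - b', c - c']"
  by (auto simp: vec_eq_iff forall_3)

lemma alg_mult_vec3:
  assumes "alg_table X = t"
  shows "alg_mult X (vector [a, b, c]) (vector [a', b', c']) =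
    (a * a') *s basis_product t 1 1 + (a * b') *s basis_product t 1 2 + (a * c') *s basis_product t 1 3
    + (b * a') *s basis_product t 2 1 + (b * b') *s basis_product t 2 2 + (b * c') *s basis_product t 2 3
    + (c * a') *s basis_product t 3 1 + (c * b') *s basis_product t 3 2 + (c * c') *s basis_product t 3 3"
  using assms by (simp add: alg_mult_def table_mult_def sum_3 algebra_simps)

lemmas table_eval = basis_product_def comm_table_def vec_eq_iff forall_3 axis_def

lemma alg_mult_A:
  fixes a b c a' b' c' :: complex
  shows
  "alg_mult A01 (vector [a, b, c]) (vector [a', b', c']) = vector [a * a', b * b', 0]"
  "alg_mult A02 (vector [a, b, c]) (vector [a', b', c']) = vector [a * a', a * b' + b * a', 0]"
  "alg_mult A03 (vector [a, b, c]) (vector [a', b', c']) = vector [a * a', 0, 0]"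
  "alg_mult A04 (vector [a, b, c]) (vector [a', b', c']) = vector [0, a * a', 0]"
  "alg_mult A05 (vector [a, b, c]) (vector [a', b', c']) = vector [0, 0, a * b' + b * a']"
  "alg_mult A06 (vector [a, b, c]) (vector [a', b', c']) = vector [0, a * a', a * b' + b * a']"
  "alg_mult A07 (vector [a, b, c]) (vector [a', b', c']) = vector [a * a', b * b', c * c']"
  "alg_mult A08 (vector [a, b, c]) (vector [a', b', c']) = vector [a * a', b * b', b * c' + c * b']"
  "alg_mult A09 (vector [a, b, c]) (vector [a', b', c']) = vector [a * a', a * b' + b * a', a * c' + c * a']"
  "alg_mult A10 (vector [a, b, c]) (vector [a', b', c']) =
     vector [a * a', a * b' + b * a', a * c' + c * a' + b * b']"
  "alg_mult A11 (vector [a, b, c]) (vector [a', b', c']) = vector [a * a', 0, b * b']"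
  by (simp_all add: alg_mult_vec3[OF refl] table_eval)

lemma alg_mult_R:
  fixes a b c a' b' c' :: complex
  shows
  "alg_mult R00 (vector [a, b, c]) (vector [a', b', c']) = vector [0, 0, a * b' - b * a']"
  "alg_mult R01 (vector [a, b, c]) (vector [a', b', c']) = vector [0, a * a' + a * c' - c * a', 0]"
  "alg_mult (R02 \<alpha>) (vector [a, b, c]) (vector [a', b', c']) =
     vector [0, 0, (1 + \<alpha>) * (a * b') + (1 - \<alpha>) * (b * a')]"
  "alg_mult R03 (vector [a, b, c]) (vector [a', b', c']) = vector [a * a', a * b', a * c' + c * a']"
  "alg_mult R04 (vector [a, b, c]) (vector [a', b', c']) =
     vector [a * a', a * b', a * b' - b * a' + a * c' + c * a']"
  "alg_mult R05 (vector [a, b, c]) (vector [a', b', c']) = vector [a * a', b * a', a * c' + c * a']"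
  "alg_mult R06 (vector [a, b, c]) (vector [a', b', c']) = vector [a * a', a * b', a * c']"
  "alg_mult R07 (vector [a, b, c]) (vector [a', b', c']) = vector [a * a', b * a', c * a']"
  "alg_mult R08 (vector [a, b, c]) (vector [a', b', c']) = vector [a * a', b * a', a * c']"
  "alg_mult R09 (vector [a, b, c]) (vector [a', b', c']) = vector [a * a', b * a', b * b']"
  "alg_mult R10 (vector [a, b, c]) (vector [a', b', c']) = vector [a * a', a * b', a * c' + c * a' + b * b']"
  "alg_mult R11 (vector [a, b, c]) (vector [a', b', c']) = vector [a * a', b * b', a * c' + c * b']"
  "alg_mult R12 (vector [a, b, c]) (vector [a', b', c']) = vector [a * a', b * a', 0]"
  "alg_mult R13 (vector [a, b, c]) (vector [a', b', c']) = vector [a * a', b * a', a * b' - b * a']"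
  "alg_mult R14 (vector [a, b, c]) (vector [a', b', c']) = vector [a * a', a * b', 0]"
  "alg_mult R15 (vector [a, b, c]) (vector [a', b', c']) = vector [a * a', b * b', a * c']"
  "alg_mult R16 (vector [a, b, c]) (vector [a', b', c']) = vector [a * a', b * b', c * a']"
  by (simp_all add: alg_mult_vec3[OF refl] table_eval algebra_simps)

lemmas alg_mult_coords = alg_mult_A alg_mult_R

section \<open>Properties preserved by isomorphisms\<close>

text \<open>Among the listed algebras this singles out those whose product takes values in an
  annihilating line: \<open>A04\<close>, \<open>A05\<close>, \<open>R00\<close>, \<open>R01\<close>
  and \<open>R02\<close>. The nilpotent algebra \<open>A06\<close> fails it, as there (e1 e1) e1 =
  e3.\<close>

definition left_nilpotent3 :: "('a::ab_group_add \<Rightarrow> 'a \<Rightarrow> 'a) \<Rightarrow> bool" where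
  "left_nilpotent3 m \<longleftrightarrow> (\<forall>x y z. m (m x y) z = 0)"
definition zero_squares :: "('a::ab_group_add \<Rightarrow> 'a \<Rightarrow> 'a) \<Rightarrow> bool" where
  "zero_squares m \<longleftrightarrow> (\<forall>x. m x x = 0)"
text \<open>For a bilinear form with values in an annihilating line this says that the symmetric
  part has rank 2: two isotropic vectors that are not orthogonal. It separates \<open>A05\<close>
  and \<open>R02\<close> from \<open>A04\<close>, \<open>R00\<close> and \<open>R01\<close>.\<close>

definition hyperbolic_pair :: "('a::ab_group_add \<Rightarrow> 'a \<Rightarrow> 'a) \<Rightarrow> bool" where
  "hyperbolic_pair m \<longleftrightarrow> (\<exists>x y. m x x = 0 \<and> m y y = 0 \<and> m x y + m y x \<noteq> 0)"
definition active_square_zero :: "('a::ab_group_add \<Rightarrow> 'a \<Rightarrow> 'a) \<Rightarrow> bool" where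
  "active_square_zero m \<longleftrightarrow> (\<exists>x y. m x x = 0 \<and> m x y \<noteq> 0)"
definition square_zero_square :: "('a::ab_group_add \<Rightarrow> 'a \<Rightarrow> 'a) \<Rightarrow> bool" where
  "square_zero_square m \<longleftrightarrow> (\<exists>x. m x x \<noteq> 0 \<and> m (m x x) (m x x) = 0)"
definition orthogonal_idempotents :: "('a::ab_group_add \<Rightarrow> 'a \<Rightarrow> 'a) \<Rightarrow> bool" where
  "orthogonal_idempotents m \<longleftrightarrow>
     (\<exists>x y. x \<noteq> 0 \<and> y \<noteq> 0 \<and> m x x = x \<and> m y y = y \<and> m x y = 0)"
definition left_annihilator :: "('a::ab_group_add \<Rightarrow> 'a \<Rightarrow> 'a) \<Rightarrow> bool" where
  "left_annihilator m \<longleftrightarrow> (\<exists>x. x \<noteq> 0 \<and> (\<forall>y. m x y = 0))"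
definition right_annihilator :: "('a::ab_group_add \<Rightarrow> 'a \<Rightarrow> 'a) \<Rightarrow> bool" where
  "right_annihilator m \<longleftrightarrow> (\<exists>x. x \<noteq> 0 \<and> (\<forall>y. m y x = 0))"
definition central_element :: "('a::ab_group_add \<Rightarrow> 'a \<Rightarrow> 'a) \<Rightarrow> bool" where
  "central_element m \<longleftrightarrow> (\<exists>x. x \<noteq> 0 \<and> (\<forall>y. m x y = m y x))"
definition left_mults_commute :: "('a::ab_group_add \<Rightarrow> 'a \<Rightarrow> 'a) \<Rightarrow> bool" where
  "left_mults_commute m \<longleftrightarrow> (\<forall>x y z. m x (m y z) = m y (m x z))"
definition commutators_right_annihilate :: "('a::ab_group_add \<Rightarrow> 'a \<Rightarrow> 'a) \<Rightarrow> bool" where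
  "commutators_right_annihilate m \<longleftrightarrow> (\<forall>x y z. m z (m x y - m y x) = 0)"

lemmas invariant_defs = commutative_def associative_def associator_def left_nilpotent3_def
  zero_squares_def hyperbolic_pair_def active_square_zero_def square_zero_square_def
  orthogonal_idempotents_def left_annihilator_def right_annihilator_def central_element_def
  left_mults_commute_def commutators_right_annihilate_def

text \<open>Each property is a first-order sentence in sum, difference, product and 0. The bijection
  carries the quantifiers over and the homomorphism laws carry the equations over, so one argument
  serves for all of them.\<close>

lemma isomorphic_invariants:
  fixes mul :: "'a::ab_group_add \<Rightarrow> 'a \<Rightarrow> 'a" and mul' :: "'b::ab_group_add \<Rightarrow> 'b \<Rightarrow> 'b"
  assumes "algebra_isomorphic scl mul scl' mul'"
  shows "commutative mul = commutative mul'" "associative mul = associative mul'"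
    "left_nilpotent3 mul = left_nilpotent3 mul'" "zero_squares mul = zero_squares mul'"
    "hyperbolic_pair mul = hyperbolic_pair mul'" "active_square_zero mul = active_square_zero mul'"
    "square_zero_square mul = square_zero_square mul'"
    "orthogonal_idempotents mul = orthogonal_idempotents mul'"
    "left_annihilator mul = left_annihilator mul'" "right_annihilator mul = right_annihilator mul'"
    "central_element mul = central_element mul'" "left_mults_commute mul = left_mults_commute mul'"
    "commutators_right_annihilate mul = commutators_right_annihilate mul'"
proof -
  obtain f where lin: "Vector_Spaces.linear scl scl' f" and bij: "bij f"
    and hom: "\<And>x y. f (mul x y) = mul' (f x) (f y)"
    using assms unfolding algebra_isomorphic_def by blast
  have add: "f (x + y) = f x + f y" for x y
    using lin by (simp add: Vector_Spaces.linear_iff)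
  have zero: "f 0 = 0" using add[of 0 0] by simp
  have diff: "f (x - y) = f x - f y" for x y
    using add[of "x - y" y] by (simp add: algebra_simps)
  have all: "(\<forall>y. Q y) \<longleftrightarrow> (\<forall>x. Q (f x))" for Q using bij by (metis bij_pointE)
  have ex: "(\<exists>y. Q y) \<longleftrightarrow> (\<exists>x. Q (f x))" for Q using bij by (metis bij_pointE)
  have eq: "f x = f y \<longleftrightarrow> x = y" for x y using bij by (auto simp: bij_def inj_eq)
  have eq0: "f x = 0 \<longleftrightarrow> x = 0" for x using eq[of x 0] zero by simp
  show "commutative mul = commutative mul'" "associative mul = associative mul'"
    "left_nilpotent3 mul = left_nilpotent3 mul'" "zero_squares mul = zero_squares mul'"
    "hyperbolic_pair mul = hyperbolic_pair mul'" "active_square_zero mul = active_square_zero mul'"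
    "square_zero_square mul = square_zero_square mul'"
    "orthogonal_idempotents mul = orthogonal_idempotents mul'"
    "left_annihilator mul = left_annihilator mul'" "right_annihilator mul = right_annihilator mul'"
    "central_element mul = central_element mul'" "left_mults_commute mul = left_mults_commute mul'"
    "commutators_right_annihilate mul = commutators_right_annihilate mul'"
    unfolding invariant_defs all ex
    by (simp_all add: hom[symmetric] add[symmetric] diff[symmetric] eq eq0)
qed

lemmas eval_simps = all_vec3 ex_vec3 alg_mult_coords vec3_simps

lemma commutative_witness: "m x y \<noteq> m y x \<Longrightarrow> \<not> commutative m"
  by (auto simp: commutative_def)

lemma associative_witness: "m (m x y) z \<noteq> m x (m y z) \<Longrightarrow> \<not> associative m"
  by (auto simp: associative_def associator_def)

lemma left_nilpotent3_witness: "m (m x y) z \<noteq> 0 \<Longrightarrow> \<not> left_nilpotent3 m"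
  by (auto simp: left_nilpotent3_def)

lemma zero_squares_witness: "m x x \<noteq> 0 \<Longrightarrow> \<not> zero_squares m"
  by (auto simp: zero_squares_def)

lemma hyperbolic_pair_witness:
  "m x x = 0 \<Longrightarrow> m y y = 0 \<Longrightarrow> m x y + m y x \<noteq> 0 \<Longrightarrow> hyperbolic_pair m"
  by (auto simp: hyperbolic_pair_def)

lemma active_square_zero_witness: "m x x = 0 \<Longrightarrow> m x y \<noteq> 0 \<Longrightarrow> active_square_zero m"
  by (auto simp: active_square_zero_def)

lemma square_zero_square_witness:
  "m x x \<noteq> 0 \<Longrightarrow> m (m x x) (m x x) = 0 \<Longrightarrow> square_zero_square m"
  by (auto simp: square_zero_square_def)

lemma orthogonal_idempotents_witness:
  "x \<noteq> 0 \<Longrightarrow> y \<noteq> 0 \<Longrightarrow> m x x = x \<Longrightarrow> m y y = y \<Longrightarrow> m x y = 0 \<Longrightarrow> orthogonal_idempotents m"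
  by (auto simp: orthogonal_idempotents_def)

lemma left_annihilator_witness: "x \<noteq> 0 \<Longrightarrow> \<forall>y. m x y = 0 \<Longrightarrow> left_annihilator m"
  by (auto simp: left_annihilator_def)

lemma right_annihilator_witness: "x \<noteq> 0 \<Longrightarrow> \<forall>y. m y x = 0 \<Longrightarrow> right_annihilator m"
  by (auto simp: right_annihilator_def)

lemma central_element_witness: "x \<noteq> 0 \<Longrightarrow> \<forall>y. m x y = m y x \<Longrightarrow> central_element m"
  by (auto simp: central_element_def)

lemma left_mults_commute_witness: "m x (m y z) \<noteq> m y (m x z) \<Longrightarrow> \<not> left_mults_commute m"
  by (auto simp: left_mults_commute_def)

lemma commutators_right_annihilate_witness:
  "m z (m x y - m y x) \<noteq> 0 \<Longrightarrow> \<not> commutators_right_annihilate m"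
  by (auto simp: commutators_right_annihilate_def)

text \<open>Testing against three basis vectors replaces the universal condition under the
  existential quantifier by finitely many linear equations in \<open>a\<close>, \<open>b\<close>,
  \<open>c\<close>, from which simplification decides that no such element exists. The next two
  lemmas serve the same end.\<close>

lemma left_annihilator_on_basis:
  fixes m :: "complex^3 \<Rightarrow> complex^3 \<Rightarrow> complex^3"
  assumes "left_annihilator m"
  shows "\<exists>a b c. \<not> (a = 0 \<and> b = 0 \<and> c = 0) \<and> m (vector [a, b, c]) (vector [1, 0, 0]) = 0
    \<and> m (vector [a, b, c]) (vector [0, 1, 0]) = 0 \<and> m (vector [a, b, c]) (vector [0, 0, 1]) = 0"
  using assms unfolding left_annihilator_def ex_vec3 vec3_simps by blast

lemma right_annihilator_on_basis:
  fixes m :: "complex^3 \<Rightarrow> complex^3 \<Rightarrow> complex^3"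
  assumes "right_annihilator m"
  shows "\<exists>a b c. \<not> (a = 0 \<and> b = 0 \<and> c = 0) \<and> m (vector [1, 0, 0]) (vector [a, b, c]) = 0
    \<and> m (vector [0, 1, 0]) (vector [a, b, c]) = 0 \<and> m (vector [0, 0, 1]) (vector [a, b, c]) = 0"
  using assms unfolding right_annihilator_def ex_vec3 vec3_simps by blast

lemma central_element_on_basis:
  fixes m :: "complex^3 \<Rightarrow> complex^3 \<Rightarrow> complex^3"
  assumes "central_element m"
  shows "\<exists>a b c. \<not> (a = 0 \<and> b = 0 \<and> c = 0) \<and> m (vector [a, b, c]) (vector [1, 0, 0]) = m (vector [1, 0, 0]) (vector [a, b, c])
    \<and> m (vector [a, b, c]) (vector [0, 1, 0]) = m (vector [0, 1, 0]) (vector [a, b, c]) \<and> m (vector [a, b, c]) (vector [0, 0, 1]) = m (vector [0, 0, 1]) (vector [a, b, c])"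
  using assms unfolding central_element_def ex_vec3 vec3_simps by blast

section \<open>Values of the invariants on the listed algebras\<close>

lemma commutative_alg_computed:
  "commutative (alg_mult A01)" "commutative (alg_mult A02)" "commutative (alg_mult A03)"
  "commutative (alg_mult A04)" "commutative (alg_mult A05)" "commutative (alg_mult A06)"
  "commutative (alg_mult A07)" "commutative (alg_mult A08)" "commutative (alg_mult A09)"
  "commutative (alg_mult A10)" "commutative (alg_mult A11)"
  by (auto simp: eval_simps commutative_def algebra_simps)

lemma commutative_alg_witness0:
  "\<not> commutative (alg_mult R00)"
  "\<alpha> \<noteq> 0 \<Longrightarrow> \<not> commutative (alg_mult (R02 \<alpha>))"
  "\<not> commutative (alg_mult R03)" "\<not> commutative (alg_mult R04)"
  "\<not> commutative (alg_mult R05)" "\<not> commutative (alg_mult R06)"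
  "\<not> commutative (alg_mult R07)" "\<not> commutative (alg_mult R08)"
  "\<not> commutative (alg_mult R09)" "\<not> commutative (alg_mult R10)"
  "\<not> commutative (alg_mult R12)" "\<not> commutative (alg_mult R13)"
  "\<not> commutative (alg_mult R14)"
  by (rule commutative_witness[where x = "vector [1, 0, 0]" and y = "vector [0, 1, 0]"];
      simp add: eval_simps)+

lemma commutative_alg_witness1:
  "\<not> commutative (alg_mult R01)" "\<not> commutative (alg_mult R11)"
  "\<not> commutative (alg_mult R15)" "\<not> commutative (alg_mult R16)"
  by (rule commutative_witness[where x = "vector [1, 0, 0]" and y = "vector [0, 0, 1]"];
      simp add: eval_simps)+

lemmas commutative_alg = commutative_alg_computed commutative_alg_witness0 commutative_alg_witness1

lemma left_nilpotent3_alg_computed: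
  "left_nilpotent3 (alg_mult A04)" "left_nilpotent3 (alg_mult A05)"
  "left_nilpotent3 (alg_mult R00)" "left_nilpotent3 (alg_mult R01)"
  "left_nilpotent3 (alg_mult (R02 \<alpha>))"
  by (auto simp: eval_simps left_nilpotent3_def algebra_simps)

lemma left_nilpotent3_alg_witness0:
  "\<not> left_nilpotent3 (alg_mult A01)" "\<not> left_nilpotent3 (alg_mult A02)"
  "\<not> left_nilpotent3 (alg_mult A03)" "\<not> left_nilpotent3 (alg_mult A06)"
  "\<not> left_nilpotent3 (alg_mult A07)" "\<not> left_nilpotent3 (alg_mult A08)"
  "\<not> left_nilpotent3 (alg_mult A09)" "\<not> left_nilpotent3 (alg_mult A10)"
  "\<not> left_nilpotent3 (alg_mult A11)" "\<not> left_nilpotent3 (alg_mult R03)"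
  "\<not> left_nilpotent3 (alg_mult R04)" "\<not> left_nilpotent3 (alg_mult R05)"
  "\<not> left_nilpotent3 (alg_mult R06)" "\<not> left_nilpotent3 (alg_mult R07)"
  "\<not> left_nilpotent3 (alg_mult R08)" "\<not> left_nilpotent3 (alg_mult R09)"
  "\<not> left_nilpotent3 (alg_mult R10)" "\<not> left_nilpotent3 (alg_mult R11)"
  "\<not> left_nilpotent3 (alg_mult R12)" "\<not> left_nilpotent3 (alg_mult R13)"
  "\<not> left_nilpotent3 (alg_mult R14)" "\<not> left_nilpotent3 (alg_mult R15)"
  "\<not> left_nilpotent3 (alg_mult R16)"
  by (rule left_nilpotent3_witness[where x = "vector [1, 0, 0]" and y = "vector [1, 0, 0]"
        and z = "vector [1, 0, 0]"];
      simp add: eval_simps)+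

lemmas left_nilpotent3_alg = left_nilpotent3_alg_computed left_nilpotent3_alg_witness0

lemma hyperbolic_pair_alg_computed:
  "\<not> hyperbolic_pair (alg_mult A04)" "\<not> hyperbolic_pair (alg_mult R00)"
  "\<not> hyperbolic_pair (alg_mult R01)"
  by (auto simp: eval_simps hyperbolic_pair_def)

lemma hyperbolic_pair_alg_witness0:
  "hyperbolic_pair (alg_mult A05)" "hyperbolic_pair (alg_mult (R02 \<alpha>))"
  by (rule hyperbolic_pair_witness[where x = "vector [1, 0, 0]" and y = "vector [0, 1, 0]"];
      simp add: eval_simps)+

lemmas hyperbolic_pair_alg = hyperbolic_pair_alg_computed hyperbolic_pair_alg_witness0

lemma zero_squares_alg_computed:
  "zero_squares (alg_mult R00)"
  by (auto simp: eval_simps zero_squares_def)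

lemma zero_squares_alg_witness0:
  "\<not> zero_squares (alg_mult R01)"
  by (rule zero_squares_witness[where x = "vector [1, 0, 0]"]; simp add: eval_simps)+

lemmas zero_squares_alg = zero_squares_alg_computed zero_squares_alg_witness0

lemma active_square_zero_alg_computed:
  "\<not> active_square_zero (alg_mult A01)" "\<not> active_square_zero (alg_mult A03)"
  "\<not> active_square_zero (alg_mult A07)" "\<not> active_square_zero (alg_mult A11)"
  by (auto simp: eval_simps active_square_zero_def)

lemma active_square_zero_alg_witness0:
  "active_square_zero (alg_mult A02)" "active_square_zero (alg_mult A06)"
  "active_square_zero (alg_mult A09)"
  by (rule active_square_zero_witness[where x = "vector [0, 1, 0]"
        and y = "vector [1, 0, 0]"];
      simp add: eval_simps)+

lemma active_square_zero_alg_witness1: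
  "active_square_zero (alg_mult A08)"
  by (rule active_square_zero_witness[where x = "vector [0, 0, 1]"
        and y = "vector [0, 1, 0]"];
      simp add: eval_simps)+

lemma active_square_zero_alg_witness2:
  "active_square_zero (alg_mult A10)"
  by (rule active_square_zero_witness[where x = "vector [0, 0, 1]"
        and y = "vector [1, 0, 0]"];
      simp add: eval_simps)+

lemmas active_square_zero_alg = active_square_zero_alg_computed
  active_square_zero_alg_witness0 active_square_zero_alg_witness1
  active_square_zero_alg_witness2

lemma square_zero_square_alg_computed:
  "\<not> square_zero_square (alg_mult A01)" "\<not> square_zero_square (alg_mult A02)"
  "\<not> square_zero_square (alg_mult A03)" "\<not> square_zero_square (alg_mult A07)"
  "\<not> square_zero_square (alg_mult A08)" "\<not> square_zero_square (alg_mult A09)"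
  "\<not> square_zero_square (alg_mult R13)"
  by (auto simp: eval_simps square_zero_square_def)

lemma square_zero_square_alg_witness0:
  "square_zero_square (alg_mult A06)"
  by (rule square_zero_square_witness[where x = "vector [1, 0, 0]"]; simp add: eval_simps)+

lemma square_zero_square_alg_witness1:
  "square_zero_square (alg_mult A10)" "square_zero_square (alg_mult A11)"
  "square_zero_square (alg_mult R09)"
  by (rule square_zero_square_witness[where x = "vector [0, 1, 0]"]; simp add: eval_simps)+

lemmas square_zero_square_alg = square_zero_square_alg_computed
  square_zero_square_alg_witness0 square_zero_square_alg_witness1

text \<open>The first coordinate is a homomorphism to the complex numbers, so of two elements with
  product 0 one lies in its kernel, and by \<open>idem\<close> the kernel contains no nonzero
  idempotent.\<close>

lemma no_orthogonal_idempotents: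
  fixes m :: "complex^3 \<Rightarrow> complex^3 \<Rightarrow> complex^3"
  assumes first: "\<And>a b c a' b' c'. m (vector [a, b, c]) (vector [a', b', c']) $ 1 = a * a'"
    and idem: "\<And>b c. m (vector [0, b, c]) (vector [0, b, c]) = vector [0, b, c] \<Longrightarrow> b = 0 \<and> c = 0"
  shows "\<not> orthogonal_idempotents m"
proof
  assume "orthogonal_idempotents m"
  then obtain a b c a' b' c' where
    *: "m (vector [a, b, c]) (vector [a', b', c']) = 0"
      "m (vector [a, b, c]) (vector [a, b, c]) = vector [a, b, c]" "vector [a, b, c] \<noteq> (0 :: complex^3)"
      "m (vector [a', b', c']) (vector [a', b', c']) = vector [a', b', c']" "vector [a', b', c'] \<noteq> (0 :: complex^3)"
    unfolding orthogonal_idempotents_def ex_vec3 by blast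
  have "a = 0 \<or> a' = 0" using first[of a b c a' b' c'] *(1) by simp
  then show False using idem * by (auto simp: vec3_simps)
qed

lemma orthogonal_idempotents_alg_computed:
  "\<not> orthogonal_idempotents (alg_mult A02)" "\<not> orthogonal_idempotents (alg_mult A03)"
  "\<not> orthogonal_idempotents (alg_mult A09)"
  "\<not> orthogonal_idempotents (alg_mult A10)" "\<not> orthogonal_idempotents (alg_mult A11)"
  "\<not> orthogonal_idempotents (alg_mult R03)" "\<not> orthogonal_idempotents (alg_mult R05)"
  "\<not> orthogonal_idempotents (alg_mult R06)" "\<not> orthogonal_idempotents (alg_mult R07)"
  by (rule no_orthogonal_idempotents; auto simp: alg_mult_coords vec3_simps)+

text \<open>In this nilpotent algebra all products have first coordinate 0, so the preceding
  criterion does not apply; the coordinates of an idempotent vanish one after the other.\<close>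

lemma orthogonal_idempotents_alg_A06: "\<not> orthogonal_idempotents (alg_mult A06)"
  by (auto simp: eval_simps orthogonal_idempotents_def)

lemma orthogonal_idempotents_alg_witness0:
  "orthogonal_idempotents (alg_mult A01)" "orthogonal_idempotents (alg_mult A07)"
  "orthogonal_idempotents (alg_mult A08)" "orthogonal_idempotents (alg_mult R15)"
  "orthogonal_idempotents (alg_mult R16)"
  by (rule orthogonal_idempotents_witness[where x = "vector [1, 0, 0]"
        and y = "vector [0, 1, 0]"];
      simp add: eval_simps)+

lemmas orthogonal_idempotents_alg = orthogonal_idempotents_alg_A06
  orthogonal_idempotents_alg_computed orthogonal_idempotents_alg_witness0

lemma left_annihilator_alg_computed:
  "\<not> left_annihilator (alg_mult A07)" "\<not> left_annihilator (alg_mult A08)"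
  "\<not> left_annihilator (alg_mult A09)" "\<not> left_annihilator (alg_mult A10)"
  "\<not> left_annihilator (alg_mult R05)" "\<not> left_annihilator (alg_mult R07)"
  "\<not> left_annihilator (alg_mult R10)" "\<not> left_annihilator (alg_mult R11)"
  "\<not> left_annihilator (alg_mult R16)"
  by (auto dest!: left_annihilator_on_basis simp: eval_simps)

lemma left_annihilator_alg_witness0:
  "left_annihilator (alg_mult A01)" "left_annihilator (alg_mult A02)"
  "left_annihilator (alg_mult A06)" "left_annihilator (alg_mult A11)"
  "left_annihilator (alg_mult R08)" "left_annihilator (alg_mult R09)"
  "left_annihilator (alg_mult R12)" "left_annihilator (alg_mult R13)"
  "left_annihilator (alg_mult R15)"
  by (rule left_annihilator_witness[where x = "vector [0, 0, 1]"]; simp add: eval_simps)+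

lemma left_annihilator_alg_witness1:
  "left_annihilator (alg_mult A03)" "left_annihilator (alg_mult R03)"
  "left_annihilator (alg_mult R06)" "left_annihilator (alg_mult R14)"
  by (rule left_annihilator_witness[where x = "vector [0, 1, 0]"]; simp add: eval_simps)+

lemma left_annihilator_alg_witness2:
  "left_annihilator (alg_mult R04)"
  by (rule left_annihilator_witness[where x = "vector [0, 1, 1]"]; simp add: eval_simps)+

lemmas left_annihilator_alg = left_annihilator_alg_computed left_annihilator_alg_witness0
  left_annihilator_alg_witness1 left_annihilator_alg_witness2

lemma right_annihilator_alg_computed:
  "\<not> right_annihilator (alg_mult R03)" "\<not> right_annihilator (alg_mult R04)"
  "\<not> right_annihilator (alg_mult R06)" "\<not> right_annihilator (alg_mult R10)"
  "\<not> right_annihilator (alg_mult R11)" "\<not> right_annihilator (alg_mult R15)"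
  by (auto dest!: right_annihilator_on_basis simp: eval_simps)

lemma right_annihilator_alg_witness0:
  "right_annihilator (alg_mult R05)" "right_annihilator (alg_mult R07)"
  "right_annihilator (alg_mult R08)" "right_annihilator (alg_mult R12)"
  by (rule right_annihilator_witness[where x = "vector [0, 1, 0]"]; simp add: eval_simps)+

lemma right_annihilator_alg_witness1:
  "right_annihilator (alg_mult R09)" "right_annihilator (alg_mult R13)"
  "right_annihilator (alg_mult R14)" "right_annihilator (alg_mult R16)"
  by (rule right_annihilator_witness[where x = "vector [0, 0, 1]"]; simp add: eval_simps)+

lemmas right_annihilator_alg = right_annihilator_alg_computed right_annihilator_alg_witness0
  right_annihilator_alg_witness1

lemma associative_alg_computed:
  "associative (alg_mult A01)" "associative (alg_mult A02)" "associative (alg_mult A03)"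
  "associative (alg_mult A04)" "associative (alg_mult A05)" "associative (alg_mult A06)"
  "associative (alg_mult A07)" "associative (alg_mult A08)" "associative (alg_mult A09)"
  "associative (alg_mult A10)" "associative (alg_mult A11)" "associative (alg_mult R03)"
  "associative (alg_mult R05)" "associative (alg_mult R06)" "associative (alg_mult R07)"
  "associative (alg_mult R08)" "associative (alg_mult R11)" "associative (alg_mult R12)"
  "associative (alg_mult R14)" "associative (alg_mult R15)" "associative (alg_mult R16)"
  by (auto simp: eval_simps associative_def associator_def algebra_simps)

lemma associative_alg_witness0:
  "\<not> associative (alg_mult R04)" "\<not> associative (alg_mult R13)"
  by (rule associative_witness[where x = "vector [1, 0, 0]" and y = "vector [1, 0, 0]"
        and z = "vector [0, 1, 0]"];
      simp add: eval_simps)+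

lemma associative_alg_witness1:
  "\<not> associative (alg_mult R09)" "\<not> associative (alg_mult R10)"
  by (rule associative_witness[where x = "vector [0, 1, 0]" and y = "vector [1, 0, 0]"
        and z = "vector [0, 1, 0]"];
      simp add: eval_simps)+

lemmas associative_alg = associative_alg_computed associative_alg_witness0 associative_alg_witness1

lemma left_mults_commute_alg_computed:
  "left_mults_commute (alg_mult R03)" "left_mults_commute (alg_mult R04)"
  "left_mults_commute (alg_mult R06)" "left_mults_commute (alg_mult R10)"
  "left_mults_commute (alg_mult R14)" "left_mults_commute (alg_mult R15)"
  by (auto simp: eval_simps left_mults_commute_def algebra_simps)

lemma left_mults_commute_alg_witness0:
  "\<not> left_mults_commute (alg_mult R05)" "\<not> left_mults_commute (alg_mult R07)"
  "\<not> left_mults_commute (alg_mult R08)" "\<not> left_mults_commute (alg_mult R09)"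
  "\<not> left_mults_commute (alg_mult R12)" "\<not> left_mults_commute (alg_mult R13)"
  by (rule left_mults_commute_witness[where x = "vector [1, 0, 0]"
        and y = "vector [0, 1, 0]" and z = "vector [1, 0, 0]"];
      simp add: eval_simps)+

lemma left_mults_commute_alg_witness1:
  "\<not> left_mults_commute (alg_mult R11)"
  by (rule left_mults_commute_witness[where x = "vector [1, 0, 0]"
        and y = "vector [0, 0, 1]" and z = "vector [0, 1, 0]"];
      simp add: eval_simps)+

lemma left_mults_commute_alg_witness2:
  "\<not> left_mults_commute (alg_mult R16)"
  by (rule left_mults_commute_witness[where x = "vector [1, 0, 0]"
        and y = "vector [0, 0, 1]" and z = "vector [1, 0, 0]"];
      simp add: eval_simps)+

lemmas left_mults_commute_alg = left_mults_commute_alg_computed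
  left_mults_commute_alg_witness0 left_mults_commute_alg_witness1
  left_mults_commute_alg_witness2

lemma commutators_right_annihilate_alg_computed:
  "commutators_right_annihilate (alg_mult R12)"
  by (auto simp: eval_simps commutators_right_annihilate_def algebra_simps)

lemma commutators_right_annihilate_alg_witness0:
  "\<not> commutators_right_annihilate (alg_mult R08)"
  by (rule commutators_right_annihilate_witness[where x = "vector [1, 0, 0]"
        and y = "vector [0, 0, 1]" and z = "vector [1, 0, 0]"];
      simp add: eval_simps)+

lemmas commutators_right_annihilate_alg = commutators_right_annihilate_alg_computed
  commutators_right_annihilate_alg_witness0

lemma central_element_alg_computed:
  "\<not> central_element (alg_mult R06)" "\<not> central_element (alg_mult R07)"
  by (auto dest!: central_element_on_basis simp: eval_simps)

lemma central_element_alg_witness0: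
  "central_element (alg_mult R03)" "central_element (alg_mult R05)"
  by (rule central_element_witness[where x = "vector [0, 0, 1]"]; simp add: eval_simps)+

lemmas central_element_alg = central_element_alg_computed central_element_alg_witness0

lemmas invariants_alg = commutative_alg left_nilpotent3_alg hyperbolic_pair_alg zero_squares_alg
  active_square_zero_alg square_zero_square_alg orthogonal_idempotents_alg left_annihilator_alg
  right_annihilator_alg associative_alg left_mults_commute_alg commutators_right_annihilate_alg
  central_element_alg

section \<open>Separation of the listed algebras\<close>

text \<open>Modulo the annihilating third basis vector, the square-zero elements form the two lines
  of \<open>e1\<close> and \<open>e2\<close>. An isomorphism either keeps these lines or swaps them,
  and a swap exchanges the factors 1 + \<beta> and 1 - \<beta>.\<close>

lemma R02_isomorphic_imp:
  assumes "algebra_isomorphic (*s) (alg_mult (R02 \<alpha>)) (*s) (alg_mult (R02 \<beta>))"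
  shows "\<beta> = \<alpha> \<or> \<beta> = - \<alpha>"
proof -
  obtain f where lin: "Vector_Spaces.linear (*s) (*s) f" and bij: "bij f"
    and hom: "\<And>x y. f (alg_mult (R02 \<alpha>) x y) = alg_mult (R02 \<beta>) (f x) (f y)"
    using assms unfolding algebra_isomorphic_def by blast
  have add: "f (x + y) = f x + f y" and scale: "f (c *s x) = c *s f x" for x y c
    using lin by (simp_all add: Vector_Spaces.linear_iff)
  have zero: "f 0 = 0" using add[of 0 0] by simp
  have inj: "f x = f y \<longleftrightarrow> x = y" for x y using bij by (auto simp: bij_def inj_eq)
  let ?x = "vector [1, 0, 0] :: complex^3" and ?y = "vector [0, 1, 0] :: complex^3"
  let ?z = "vector [0, 0, 1] :: complex^3"
  obtain a b c where fx: "f ?x = vector [a, b, c]" using ex_vec3[of "\<lambda>v. f ?x = v"] by blast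
  obtain a' b' c' where fy: "f ?y = vector [a', b', c']" using ex_vec3[of "\<lambda>v. f ?y = v"] by blast
  obtain p q r where fz: "f ?z = vector [p, q, r]" using ex_vec3[of "\<lambda>v. f ?z = v"] by blast
  have z: "?z \<noteq> 0" by (simp add: vec3_simps)
  have scale_vec: "t *s vector [a1, a2, a3] = (vector [t * a1, t * a2, t * a3] :: complex^3)" for t a1 a2 a3
    by (simp add: vec_eq_iff forall_3)
  have vec3_zero: "vector [0, 0, 0] = (0 :: complex^3)" by (simp add: vec3_simps)
  have r: "r \<noteq> 0 \<and> p = 0 \<and> q = 0"
    and xx: "a = 0 \<or> b = 0"
    and xy: "(1 + \<alpha>) * r = (1 + \<beta>) * (a * b') + (1 - \<beta>) * (b * a')"
    and yx: "(1 - \<alpha>) * r = (1 + \<beta>) * (a' * b) + (1 - \<beta>) * (b' * a)"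
  proof -
    have xx': "f 0 = alg_mult (R02 \<beta>) (f ?x) (f ?x)"
      using hom[of ?x ?x] by (simp add: alg_mult_coords vec3_zero)
    \<comment> \<open>The square of \<open>(a, b, c)\<close> is \<open>2 a b\<close> times the third
      basis vector.\<close>
    then show "a = 0 \<or> b = 0"
      by (simp add: fx zero alg_mult_coords algebra_simps eq_commute[of 0] vec3_simps)
    have 1: "(1 + \<alpha>) *s f ?z = alg_mult (R02 \<beta>) (f ?x) (f ?y)"
      using hom[of ?x ?y] scale[of "1 + \<alpha>" ?z] by (simp add: alg_mult_coords scale_vec)
    then show "(1 + \<alpha>) * r = (1 + \<beta>) * (a * b') + (1 - \<beta>) * (b * a')"
      by (simp add: fx fy fz alg_mult_coords scale_vec vec3_simps)
    have 2: "(1 - \<alpha>) *s f ?z = alg_mult (R02 \<beta>) (f ?y) (f ?x)"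
      using hom[of ?y ?x] scale[of "1 - \<alpha>" ?z] by (simp add: alg_mult_coords scale_vec)
    then show "(1 - \<alpha>) * r = (1 + \<beta>) * (a' * b) + (1 - \<beta>) * (b' * a)"
      by (simp add: fx fy fz alg_mult_coords scale_vec vec3_simps)
    \<comment> \<open>The factors 1 + \<alpha> and 1 - \<alpha> add up to 2, so at least one of them
      can be cancelled.\<close>
    have "(1 + \<alpha>) * p = 0" "(1 - \<alpha>) * p = 0" "(1 + \<alpha>) * q = 0" "(1 - \<alpha>) * q = 0"
      using 1 2 by (simp_all add: fx fy fz alg_mult_coords scale_vec vec3_simps)
    then have "p = 0" "q = 0" by (auto simp: add_eq_0_iff)
    moreover have "vector [p, q, r] \<noteq> (0 :: complex^3)"
      using z inj[of ?z 0] zero fz by simp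
    ultimately show "r \<noteq> 0 \<and> p = 0 \<and> q = 0" by (simp add: vec3_simps)
  qed
  \<comment> \<open>Half the sum of \<open>xy\<close> and \<open>yx\<close>: the skew part, and with
    it both parameters, drops out.\<close>
  have "r = a * b' + b * a'" using xy yx by algebra
  with xx show ?thesis
  proof (elim disjE)
    assume "a = 0"
    with xy r \<open>r = a * b' + b * a'\<close> have "(1 + \<alpha>) * r = (1 - \<beta>) * r" by simp
    then have "(\<beta> + \<alpha>) * r = 0" by (simp add: algebra_simps)
    with r show ?thesis by (simp add: eq_neg_iff_add_eq_0)
  next
    assume "b = 0"
    with xy r \<open>r = a * b' + b * a'\<close> have "(1 + \<alpha>) * r = (1 + \<beta>) * r" by simp
    with r show ?thesis by simp
  qed
qed

lemma R02_isomorphic_uminus: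
  "algebra_isomorphic (*s) (alg_mult (R02 \<alpha>)) (*s) (alg_mult (R02 (- \<alpha>)))"
proof -
  define f :: "complex^3 \<Rightarrow> complex^3" where "f v = vector [v $ 2, v $ 1, v $ 3]" for v
  have invol: "f (f v) = v" for v by (simp add: f_def vec_eq_iff forall_3)
  have "Vector_Spaces.linear (*s) (*s) f"
    by unfold_locales (simp_all add: f_def vec_eq_iff forall_3 algebra_simps)
  moreover have "bij f" by (rule involuntory_imp_bij[OF invol])
  moreover have "\<forall>x y. f (alg_mult (R02 \<alpha>) x y) = alg_mult (R02 (- \<alpha>)) (f x) (f y)"
    by (simp add: all_vec3 f_def alg_mult_coords algebra_simps)
  ultimately show ?thesis unfolding algebra_isomorphic_def by blast
qed

lemma algebra_isomorphic_refl:
  assumes "vector_space scl"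
  shows "algebra_isomorphic scl mul scl mul"
proof -
  interpret vector_space scl by fact
  show ?thesis unfolding algebra_isomorphic_def by (intro exI[of _ id] conjI linear_id) auto
qed

text \<open>Commutativity and \<open>left_nilpotent3\<close> cut the list into four blocks that an
  isomorphism respects. Within a block, any two distinct entries differ in one of the invariants
  quoted there, except for two members of the family \<open>R02\<close>, whose parameters are
  compared directly.\<close>

lemma alg_isomorphic_imp:
  assumes X: "X \<in> A_list \<union> R_list" and Y: "Y \<in> A_list \<union> R_list"
    and iso: "algebra_isomorphic (*s) (alg_mult X) (*s) (alg_mult Y)"
  shows "X = Y \<or> (\<exists>\<alpha>. X = R02 \<alpha> \<and> Y = R02 (- \<alpha>))" (is ?eq)
proof -
  have R02: "\<beta> = \<alpha> \<or> \<beta> = - \<alpha>" if "X = R02 \<alpha>" "Y = R02 \<beta>" for \<alpha> \<beta>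
    using iso R02_isomorphic_imp unfolding that by blast
  note inv = isomorphic_invariants[OF iso]
  note split = A_list_def R_list_def Un_iff insert_iff empty_iff mem_Collect_eq
  consider "X \<in> {A01, A02, A03, A06, A07, A08, A09, A10, A11}" | "X \<in> {A04, A05}"
    | "X \<in> {R00, R01} \<union> {R02 \<alpha> |\<alpha>. \<alpha> \<noteq> 0}"
    | "X \<in> {R03, R04, R05, R06, R07, R08, R09, R10, R11, R12, R13, R14, R15, R16}"
    using X unfolding A_list_def R_list_def by blast
  then show ?eq
  proof cases
    case 1
    then have "commutative (alg_mult Y)" "\<not> left_nilpotent3 (alg_mult Y)"
      using inv(1,3) by (auto simp: invariants_alg)
    then have "Y \<in> {A01, A02, A03, A06, A07, A08, A09, A10, A11}"
      using Y unfolding split by (elim disjE exE conjE; simp add: invariants_alg)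
    with 1 inv(6,7,8,9) show ?thesis
      unfolding insert_iff empty_iff by (elim disjE; simp add: invariants_alg)
  next
    case 2
    then have "commutative (alg_mult Y)" "left_nilpotent3 (alg_mult Y)"
      using inv(1,3) by (auto simp: invariants_alg)
    then have "Y \<in> {A04, A05}"
      using Y unfolding split by (elim disjE exE conjE; simp add: invariants_alg)
    with 2 inv(5) show ?thesis
      unfolding insert_iff empty_iff by (elim disjE; simp add: invariants_alg)
  next
    case 3
    then have "\<not> commutative (alg_mult Y)" "left_nilpotent3 (alg_mult Y)"
      using inv(1,3) by (auto simp: invariants_alg)
    then have "Y \<in> {R00, R01} \<union> {R02 \<alpha> |\<alpha>. \<alpha> \<noteq> 0}"
      using Y unfolding split by (elim disjE exE conjE; simp add: invariants_alg)
    with 3 inv(4,5) R02 show ?thesis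
      unfolding split by (elim disjE exE conjE; simp add: invariants_alg; metis)
  next
    case 4
    then have "\<not> commutative (alg_mult Y)" "\<not> left_nilpotent3 (alg_mult Y)"
      using inv(1,3) by (auto simp: invariants_alg)
    then have "Y \<in> {R03, R04, R05, R06, R07, R08, R09, R10, R11, R12, R13, R14, R15, R16}"
      using Y unfolding split by (elim disjE exE conjE; simp add: invariants_alg)
    with 4 inv(2,7-13) show ?thesis
      unfolding insert_iff empty_iff by (elim disjE; simp add: invariants_alg)
  qed
qed

lemma alg_isomorphic_iff:
  assumes "X \<in> A_list \<union> R_list" "Y \<in> A_list \<union> R_list"
  shows "algebra_isomorphic (*s) (alg_mult X) (*s) (alg_mult Y)
    \<longleftrightarrow> X = Y \<or> (\<exists>\<alpha>. X = R02 \<alpha> \<and> Y = R02 (- \<alpha>))"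
  using alg_isomorphic_imp[OF assms] algebra_isomorphic_refl[OF vec.vector_space_axioms]
    R02_isomorphic_uminus by auto

section \<open>Coordinates in a three-dimensional algebra\<close>

locale right_alternative_algebra3 = complex_algebra scl mul
  for scl :: "complex \<Rightarrow> 'a::ab_group_add \<Rightarrow> 'a" and mul :: "'a \<Rightarrow> 'a \<Rightarrow> 'a" +
  assumes dim3: "dim (UNIV :: 'a set) = 3"
    and right_alt: "right_alternative mul"
begin

lemma mul_add_left: "mul (x + y) z = mul x z + mul y z"
  and mul_scale_left: "mul (scl c x) z = scl c (mul x z)"
  and mul_add_right: "mul z (x + y) = mul z x + mul z y"
  and mul_scale_right: "mul z (scl c x) = scl c (mul z x)"
  using linear_mult_left[of z] linear_mult_right[of z] by (simp_all add: Vector_Spaces.linear_iff)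

lemma mul_zero_left [simp]: "mul 0 z = 0"
  and mul_zero_right [simp]: "mul z 0 = 0"
  using mul_add_left[of 0 0 z] mul_add_right[of z 0 0] by simp_all

lemma mul_minus_left: "mul (- x) z = - mul x z"
  and mul_minus_right: "mul z (- x) = - mul z x"
  using mul_add_left[of x "- x" z] mul_add_right[of z x "- x"]
  by (simp_all add: eq_neg_iff_add_eq_0 add.commute)

lemma mul_diff_left: "mul (x - y) z = mul x z - mul y z"
  and mul_diff_right: "mul z (x - y) = mul z x - mul z y"
  using mul_add_left[of x "- y" z] mul_add_right[of z x "- y"]
  by (simp_all add: mul_minus_left mul_minus_right)

lemma right_alt_linearized: "mul (mul x y) z + mul (mul x z) y = mul x (mul y z) + mul x (mul z y)"
  using right_alt unfolding right_alternative_def associator_def by (simp add: algebra_simps)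

lemma right_alt_square: "mul (mul x y) y = mul x (mul y y)"
proof -
  have "scl 2 (mul (mul x y) y) = scl 2 (mul x (mul y y))"
    using right_alt_linearized[of x y y] scale_left_distrib[of 1 1] by simp
  then show ?thesis by simp
qed

definition lc :: "'a \<Rightarrow> 'a \<Rightarrow> 'a \<Rightarrow> complex \<Rightarrow> complex \<Rightarrow> complex \<Rightarrow> 'a" where
  "lc e u v a b c = scl a e + scl b u + scl c v"

text \<open>Only linear independence is required; in dimension 3 spanning follows from it, see
  \<open>basis3_span\<close>.\<close>

definition basis3 :: "'a \<Rightarrow> 'a \<Rightarrow> 'a \<Rightarrow> bool" where
  "basis3 e u v \<longleftrightarrow> (\<forall>a b c. lc e u v a b c = 0 \<longrightarrow> a = 0 \<and> b = 0 \<and> c = 0)"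

lemma lc_add: "lc e u v a b c + lc e u v a' b' c' = lc e u v (a + a') (b + b') (c + c')"
  and lc_diff: "lc e u v a b c - lc e u v a' b' c' = lc e u v (a - a') (b - b') (c - c')"
  and lc_minus: "- lc e u v a b c = lc e u v (- a) (- b) (- c)"
  and lc_scale: "scl k (lc e u v a b c) = lc e u v (k * a) (k * b) (k * c)"
  and lc_zero: "lc e u v 0 0 0 = 0"
  by (simp_all add: lc_def algebra_simps scale_left_diff_distrib)

lemma lc_unit: "lc e u v 1 0 0 = e" "lc e u v 0 1 0 = u" "lc e u v 0 0 1 = v"
  by (simp_all add: lc_def)

lemma mul_lc_left: "mul (lc e u v a b c) z = scl a (mul e z) + scl b (mul u z) + scl c (mul v z)"
  and mul_lc_right: "mul z (lc e u v a b c) = scl a (mul z e) + scl b (mul z u) + scl c (mul z v)"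
  by (simp_all add: lc_def mul_add_left mul_add_right mul_scale_left mul_scale_right)

lemma lc_eq_iff:
  assumes "basis3 e u v"
  shows "lc e u v a b c = lc e u v a' b' c' \<longleftrightarrow> a = a' \<and> b = b' \<and> c = c'"
proof
  assume "lc e u v a b c = lc e u v a' b' c'"
  then have "lc e u v (a - a') (b - b') (c - c') = 0" by (simp flip: lc_diff)
  then show "a = a' \<and> b = b' \<and> c = c'" using assms unfolding basis3_def by fastforce
qed simp

lemma lc_eq_0_iff:
  assumes "basis3 e u v"
  shows "lc e u v a b c = 0 \<longleftrightarrow> a = 0 \<and> b = 0 \<and> c = 0"
  using lc_eq_iff[OF assms, of a b c 0 0 0] by (simp add: lc_zero)

text \<open>The dimension is the \<open>card\<close> of a basis, and \<open>card\<close> is 0 on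
  infinite sets, so the value 3 does provide a finite basis.\<close>

lemma finite_basis: obtains B where "finite_dimensional_vector_space scl B"
proof -
  obtain B where B: "independent B" "UNIV \<subseteq> span B" "card B = dim (UNIV :: 'a set)"
    using basis_exists[of UNIV] by metis
  then have "finite B" using dim3 card_ge_0_finite by fastforce
  with B have "finite_dimensional_vector_space scl B" by unfold_locales auto
  then show ?thesis by (rule that)
qed

lemma basis3_independent:
  assumes "basis3 e u v"
  shows "independent {e, u, v}" "card {e, u, v} = 3"
proof -
  note z = lc_eq_0_iff[OF assms]
  have neq: "e \<noteq> u" "e \<noteq> v" "u \<noteq> v"
    using z[of 1 "-1" 0] z[of 1 0 "-1"] z[of 0 1 "-1"] by (auto simp: lc_def)
  then show "card {e, u, v} = 3" by simp
  show "independent {e, u, v}"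
  proof (rule independent_if_scalars_zero)
    fix f x assume s: "(\<Sum>x\<in>{e, u, v}. scl (f x) x) = 0" and x: "x \<in> {e, u, v}"
    have "lc e u v (f e) (f u) (f v) = 0" using s neq by (simp add: lc_def add.assoc)
    then show "f x = 0" using z x by auto
  qed simp
qed

lemma basis3_span:
  assumes "basis3 e u v"
  obtains a b c where "x = lc e u v a b c"
proof -
  obtain B where "finite_dimensional_vector_space scl B" by (rule finite_basis)
  then interpret finite_dimensional_vector_space scl B .
  have "span {e, u, v} = UNIV"
    using card_ge_dim_independent[of "{e, u, v}" UNIV] basis3_independent[OF assms] dim3 by auto
  then have "x \<in> span {e, u, v}" by simp
  then have "\<exists>a b c. x = lc e u v a b c"
    by (auto simp: span_insert lc_def algebra_simps)
  then show ?thesis using that by blast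
qed

text \<open>With \<open>S\<close> a union of eigenspaces this yields a basis of eigenvectors that
  begins with a prescribed vector.\<close>

lemma extend_basis3:
  assumes S: "span S = UNIV" and e: "e \<in> S" "e \<noteq> 0"
  obtains u v where "u \<in> S" "v \<in> S" "basis3 e u v"
proof -
  have "independent {e}" using e by simp
  then obtain C where C: "{e} \<subseteq> C" "C \<subseteq> S" "independent C" "S \<subseteq> span C"
    using maximal_independent_subset_extend[of "{e}" S] e by auto
  have "UNIV \<subseteq> span C" using C(4) S span_minimal[OF C(4)] by simp
  then have "card C = 3" using C(3) dim3 basis_card_eq_dim[of C UNIV] by simp
  then obtain u v where uv: "C = {e, u, v}" "e \<noteq> u" "e \<noteq> v" "u \<noteq> v"
    using C(1) by (auto simp: card_3_iff) 
  have "basis3 e u v"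
    unfolding basis3_def
  proof (intro allI impI)
    fix a b c assume z: "lc e u v a b c = 0"
    define f where "f x = (if x = e then a else if x = u then b else c)" for x
    have "(\<Sum>x\<in>C. scl (f x) x) = 0" using z uv by (simp add: f_def lc_def add.assoc)
    then have "f x = 0" if "x \<in> C" for x
      using independentD[OF C(3) _ subset_refl, of f x] that \<open>card C = 3\<close> card_ge_0_finite[of C] by auto
    from this[of e] this[of u] this[of v] show "a = 0 \<and> b = 0 \<and> c = 0"
      using uv by (simp add: f_def)
  qed
  then show ?thesis using that uv C(2) by blast
qed

lemma basis3_swap: "basis3 e u v \<Longrightarrow> basis3 e v u"
  unfolding basis3_def lc_def by (metis add.assoc add.commute)

lemma basis3_rotate: "basis3 e u v \<Longrightarrow> basis3 u v e"
  unfolding basis3_def lc_def by (metis add.assoc add.commute)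

definition listed :: bool where
  "listed \<longleftrightarrow> (\<exists>X\<in>A_list \<union> R_list. algebra_isomorphic scl mul (*s) (alg_mult X))"

text \<open>Change of coordinates: with new basis vectors given in an old basis, everything is
  pulled back to the old one, and \<open>basis3\<close> for the new triple becomes a linear system
  in three unknowns.\<close>

lemma lc_nested: "lc (lc e u v a1 a2 a3) (lc e u v b1 b2 b3) (lc e u v c1 c2 c3) x y z =
    lc e u v (x * a1 + y * b1 + z * c1) (x * a2 + y * b2 + z * c2) (x * a3 + y * b3 + z * c3)"
  unfolding lc_def[of "lc e u v a1 a2 a3"] by (simp add: lc_scale lc_add)

lemmas lc_simps = lc_add lc_diff lc_minus lc_scale lc_zero lc_nested mul_lc_left mul_lc_right

text \<open>The coordinate map \<open>g\<close> from \<open>complex^3\<close> is linear and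
  bijective, and by bilinearity it is multiplicative once the nine products of basis vectors agree
  with the table; its inverse is the isomorphism sought. Each case of the classification ends here
  with a choice of \<open>X\<close> and of the basis \<open>x\<close>, \<open>y\<close>,
  \<open>z\<close>.\<close>

lemma listedI:
  assumes B: "basis3 x y z" and X: "X \<in> A_list \<union> R_list" and t: "alg_table X = t"
    and prods:
      "mul x x = lc x y z (basis_product t 1 1 $ 1) (basis_product t 1 1 $ 2) (basis_product t 1 1 $ 3)"
      "mul x y = lc x y z (basis_product t 1 2 $ 1) (basis_product t 1 2 $ 2) (basis_product t 1 2 $ 3)"
      "mul x z = lc x y z (basis_product t 1 3 $ 1) (basis_product t 1 3 $ 2) (basis_product t 1 3 $ 3)"
      "mul y x = lc x y z (basis_product t 2 1 $ 1) (basis_product t 2 1 $ 2) (basis_product t 2 1 $ 3)"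
      "mul y y = lc x y z (basis_product t 2 2 $ 1) (basis_product t 2 2 $ 2) (basis_product t 2 2 $ 3)"
      "mul y z = lc x y z (basis_product t 2 3 $ 1) (basis_product t 2 3 $ 2) (basis_product t 2 3 $ 3)"
      "mul z x = lc x y z (basis_product t 3 1 $ 1) (basis_product t 3 1 $ 2) (basis_product t 3 1 $ 3)"
      "mul z y = lc x y z (basis_product t 3 2 $ 1) (basis_product t 3 2 $ 2) (basis_product t 3 2 $ 3)"
      "mul z z = lc x y z (basis_product t 3 3 $ 1) (basis_product t 3 3 $ 2) (basis_product t 3 3 $ 3)"
  shows listed
proof -
  define g where "g w = lc x y z (w $ 1) (w $ 2) (w $ 3)" for w :: "complex^3"
  note lin = g_def
  note eq = lc_eq_iff[OF B]
  have inj: "inj g"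
    by (rule injI) (simp add: lin eq vec_eq_iff forall_3)
  have "\<exists>v. w = g v" for w
  proof -
    obtain a b c where "w = lc x y z a b c" using basis3_span[OF B] by blast
    then show ?thesis by (intro exI[of _ "vector [a, b, c]"]) (simp add: lin)
  qed
  then have surj: "surj g" by (simp add: surj_def)
  have g_add: "g (v + w) = g v + g w" and g_scale: "g (k *s v) = scl k (g v)" for v w k
    by (simp_all add: lin lc_add lc_scale)
  have hom: "g (alg_mult X v w) = mul (g v) (g w)" for v w
    using prods t unfolding lin[symmetric]
    by (simp add: alg_mult_def table_mult_def sum_3 g_add g_scale)
       (simp add: lin mul_lc_left mul_lc_right lc_add lc_scale algebra_simps)
  define f where "f = inv g"
  have gf: "g (f u) = u" and fg: "f (g w) = w" for u w
    using inj surj by (simp_all add: f_def surj_f_inv_f)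
  have "Vector_Spaces.linear scl (*s) f"
    by unfold_locales (auto intro!: injD[OF inj] simp: gf g_add g_scale vec.scale_right_distrib algebra_simps)
  moreover have "bij f" by (rule bij_betw_byWitness[of _ g]) (auto simp: gf fg)
  moreover have "f (mul u v) = alg_mult X (f u) (f v)" for u v
    by (rule injD[OF inj]) (simp add: gf hom)
  ultimately show ?thesis
    using X unfolding listed_def algebra_isomorphic_def by blast
qed

section \<open>Peirce decomposition\<close>

definition peirce :: "'a \<Rightarrow> complex \<Rightarrow> 'a \<Rightarrow> bool" where
  "peirce e k x \<longleftrightarrow> mul e x + mul x e = scl k x"

context
  fixes e assumes idem: "mul e e = e"
begin

lemma idem_right_twice: "mul (mul x e) e = mul x e"
  by (simp add: right_alt_square idem)

text \<open>Let L and R be left and right multiplication by \<open>e\<close>, composed from right to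
  left. The linearized identity reads L(L + R) = L + RL. Applied to \<open>y\<close> and then to (L
  + R)y, with RR = R, it leaves 2 Lz = 2 z for z = RLy.\<close>

lemma mul_idem_sandwich: "mul e (mul (mul e y) e) = mul (mul e y) e"
proof -
  define z where "z = mul (mul e y) e"
  have T: "mul e (mul e w) + mul e (mul w e) = mul e w + mul (mul e w) e" for w
    using right_alt_linearized[of e w e] by (simp add: idem add.commute)
  have ze: "mul z e = z" by (simp add: z_def idem_right_twice)
  define t where "t = mul e y + mul y e"
  have et: "mul e t = mul e y + z" using T[of y] by (simp add: t_def mul_add_right z_def)
  have te: "mul t e = z + mul y e" by (simp add: t_def mul_add_left z_def idem_right_twice)
  have zz: "mul (mul e y) e = z" by (simp add: z_def)
  have "mul e (mul e t + mul t e) = mul e t + mul (mul e t) e"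
    using T[of t] by (simp add: mul_add_right)
  then have "mul e (t + (z + z)) = mul e y + z + (z + z)"
    unfolding et te by (simp add: t_def mul_add_left zz ze algebra_simps)
  then have "mul e z + mul e z = z + z"
    unfolding mul_add_right[of e t] et by (simp add: mul_add_right)
  then have "scl 2 (mul e z) = scl 2 z"
    by (simp add: scale_left_distrib[of 1 1, simplified])
  then show ?thesis by (simp add: z_def)
qed

text \<open>With L and R as before, Rx = - Lx and RR = R give RLx = - Rx. The sandwich lemma makes L
  fix Rx, and then L(L + R) = L + RL forces Lx = Rx.\<close>

lemma peirce_0_D:
  assumes "peirce e 0 x"
  shows "mul e x = 0" "mul x e = 0"
proof -
  have T: "mul e x + mul x e = 0" using assms by (simp add: peirce_def)
  have "mul (mul e x + mul x e) e = 0" by (simp add: T)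
  then have 1: "mul (mul e x) e = - mul x e"
    by (simp add: mul_add_left idem_right_twice eq_neg_iff_add_eq_0)
  have "mul e (mul x e) = mul x e"
    using mul_idem_sandwich[of x] by (simp add: 1 mul_minus_right)
  moreover have "mul e (mul e x) = - mul x e"
    using T by (metis add_eq_0_iff mul_minus_right calculation minus_unique add.commute)
  moreover have "mul e (mul e x) + mul e (mul x e) = mul e x + mul (mul e x) e"
    using right_alt_linearized[of e x e] by (simp add: idem add.commute)
  ultimately have "mul e x = mul x e" using 1 by simp
  with T have "scl 2 (mul x e) = 0" using scale_left_distrib[of 1 1] by simp
  then show "mul x e = 0" by simp
  then show "mul e x = 0" using \<open>mul e x = mul x e\<close> by simp
qed

lemma peirce_2_D:
  assumes "peirce e 2 x"
  shows "mul e x = x" "mul x e = x"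
proof -
  have T: "mul e x = scl 2 x - mul x e" using assms by (simp add: peirce_def algebra_simps)
  have 1: "mul (mul e x) e = mul x e"
    unfolding T by (simp add: mul_diff_left mul_add_left mul_scale_left idem_right_twice algebra_simps
        scale_left_distrib[of 1 1, simplified])
  have "mul e (mul x e) = mul x e" using mul_idem_sandwich[of x] by (simp add: 1)
  moreover have "mul e (mul e x) + mul e (mul x e) = mul e x + mul (mul e x) e"
    using right_alt_linearized[of e x e] by (simp add: idem add.commute)
  moreover have "mul e (mul e x) = scl 2 (mul e x) - mul e (mul x e)"
    using arg_cong[OF T, of "mul e"] by (simp add: mul_diff_right mul_scale_right)
  ultimately have "mul e x = mul x e"
    by (simp add: 1 scale_left_distrib[of 1 1, simplified])
  with T have "scl 2 (mul x e) = scl 2 x"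
    by (simp add: scale_left_distrib[of 1 1, simplified] algebra_simps)
  then show "mul x e = x" by simp
  then show "mul e x = x" using \<open>mul e x = mul x e\<close> by simp
qed

text \<open>Put T = L + R. The identities give TT = T + 2 RL, so the three components are the
  Lagrange projections (T-1)(T-2)/2, T(2-T) and T(T-1)/2 for the eigenvalues 0, 1, 2.\<close>

lemma peirce_decomposition:
  shows "x = (x - (mul e x + mul x e) + mul (mul e x) e)
      + (mul e x + mul x e - scl 2 (mul (mul e x) e)) + mul (mul e x) e"
    and "peirce e 0 (x - (mul e x + mul x e) + mul (mul e x) e)"
    and "peirce e 1 (mul e x + mul x e - scl 2 (mul (mul e x) e))"
    and "peirce e 2 (mul (mul e x) e)"
proof -
  define z where "z = mul (mul e x) e"
  have z: "mul e z = z" "mul z e = z" by (simp_all add: z_def mul_idem_sandwich idem_right_twice)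
  have *: "mul e (mul e x + mul x e) = mul e x + z"
    using right_alt_linearized[of e x e] by (simp add: idem mul_add_right z_def algebra_simps)
  have **: "mul (mul e x + mul x e) e = z + mul x e"
    by (simp add: mul_add_left z_def idem_right_twice)
  note dbl = scale_left_distrib[of 1 1, simplified]
  show "x = (x - (mul e x + mul x e) + mul (mul e x) e)
      + (mul e x + mul x e - scl 2 (mul (mul e x) e)) + mul (mul e x) e"
    by (simp add: dbl algebra_simps)
  show "peirce e 0 (x - (mul e x + mul x e) + mul (mul e x) e)"
    unfolding peirce_def z_def[symmetric] using * **
    by (simp only: mul_add_left mul_add_right mul_diff_left mul_diff_right z) (simp add: algebra_simps)
  show "peirce e 1 (mul e x + mul x e - scl 2 (mul (mul e x) e))"
    unfolding peirce_def z_def[symmetric]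
    by (simp only: mul_diff_left mul_diff_right mul_scale_left mul_scale_right z * **)
      (simp add: dbl algebra_simps)
  show "peirce e 2 (mul (mul e x) e)"
    unfolding peirce_def z_def[symmetric] by (simp add: z dbl)
qed

lemma peirce_basis:
  assumes "e \<noteq> 0"
  obtains u v i j where "basis3 e u v" "peirce e i u" "peirce e j v"
    "i \<in> {0, 1, 2}" "j \<in> {0, 1, 2}"
proof -
  let ?S = "{x. peirce e 0 x} \<union> {x. peirce e 1 x} \<union> {x. peirce e 2 x}"
  have "x \<in> span ?S" for x
    by (subst peirce_decomposition(1))
      (intro span_add span_base UnI1[OF UnI1] UnI1[OF UnI2] UnI2 CollectI peirce_decomposition)
  then have "span ?S = UNIV" by blast
  moreover have "e \<in> ?S" by (simp add: peirce_def idem scale_left_distrib[of 1 1, simplified])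
  ultimately obtain u v where "basis3 e u v" "u \<in> ?S" "v \<in> ?S"
    using extend_basis3[of ?S e] assms by blast
  then show ?thesis using that by blast
qed

end

end

lemma complex_add_self_eq_0: "(a::complex) + a = 0 \<longleftrightarrow> a = 0"
  by (simp flip: mult_2)

lemma complex_quadratic_root: obtains t :: complex where "t * t = q * t + p"
proof -
  have "(csqrt (q\<^sup>2 + 4 * p)) ^ 2 = q\<^sup>2 + 4 * p" by simp
  then have "((q + csqrt (q\<^sup>2 + 4 * p)) / 2) * ((q + csqrt (q\<^sup>2 + 4 * p)) / 2)
      = q * ((q + csqrt (q\<^sup>2 + 4 * p)) / 2) + p"
    by (simp add: field_simps power2_eq_square)
  then show ?thesis by (rule that)
qed

lemmas table_simps = basis_product_def comm_table_def axis_def A_list_def R_list_def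

context right_alternative_algebra3
begin

section \<open>Algebras with an idempotent\<close>

text \<open>The span of \<open>e\<close> and \<open>u\<close> is the quotient of the polynomial ring
  by X^2 - qX - p: dual numbers if the two roots coincide, and otherwise two copies of the complex
  numbers.\<close>

lemma unital_plane:
  assumes B: "basis3 e u v" and ee: "mul e e = e" and eu: "mul e u = u" "mul u e = u"
    and uu: "mul u u = lc e u v p q 0"
  obtains n where "basis3 e n v" "mul e n = n" "mul n e = n" "mul n n = 0 \<or> mul n n = n"
proof -
  have P: "mul e e = lc e u v 1 0 0" "mul e u = lc e u v 0 1 0" "mul u e = lc e u v 0 1 0"
    "mul u u = lc e u v p q 0"
    using ee eu uu by (simp_all add: lc_unit)
  note S = P lc_simps lc_eq_iff[OF B] lc_eq_0_iff[OF B]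
  obtain t where t: "t * t = q * t + p" by (rule complex_quadratic_root)
  \<comment> \<open>The other root minus \<open>t\<close>. Then \<open>u - t e\<close> has square
    \<open>s (u - t e)\<close>, so dividing it by a nonzero \<open>s\<close> gives an
    idempotent.\<close>
  define s where "s = q - 2 * t"
  define k where "k = (if s = 0 then 1 else 1 / s)"
  define n where "n = lc e u v (- t * k) k 0"
  have "k \<noteq> 0" by (simp add: k_def)
  have "basis3 (lc e u v 1 0 0) n (lc e u v 0 0 1)"
    unfolding n_def basis3_def using \<open>k \<noteq> 0\<close> by (simp add: S)
  moreover have "mul e n = n" "mul n e = n" by (simp_all add: n_def S)
  moreover have "mul n n = lc e u v (- t * k * k * s) (k * k * s) 0"
    unfolding n_def using t by (simp add: S s_def) (algebra)
  then have "mul n n = 0 \<or> mul n n = n"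
    by (cases "s = 0") (simp_all add: n_def S k_def)
  ultimately show ?thesis using that by (simp add: lc_unit)
qed

section \<open>Idempotents with a one-dimensional \<open>J_0\<close>\<close>

lemma peirce_20_products:
  assumes B: "basis3 e u v" and ee: "mul e e = e" and eu: "mul e u = u" "mul u e = u"
    and ev: "mul e v = 0" "mul v e = 0"
  shows "mul u v = 0" "mul v u = 0" "\<exists>p q. mul u u = lc e u v p q 0" "\<exists>r. mul v v = scl r v"
proof -
  obtain p1 p2 p3 where p: "mul u u = lc e u v p1 p2 p3" using basis3_span[OF B] by blast
  obtain q1 q2 q3 where q: "mul u v = lc e u v q1 q2 q3" using basis3_span[OF B] by blast
  obtain r1 r2 r3 where r: "mul v u = lc e u v r1 r2 r3" using basis3_span[OF B] by blast
  obtain s1 s2 s3 where s: "mul v v = lc e u v s1 s2 s3" using basis3_span[OF B] by blast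
  have P: "mul e e = lc e u v 1 0 0" "mul e u = lc e u v 0 1 0" "mul u e = lc e u v 0 1 0"
    using ee eu by (simp_all add: lc_unit)
  note S = P p q r s ev lc_simps lc_eq_iff[OF B] lc_eq_0_iff[OF B] complex_add_self_eq_0
  show "mul u v = 0"
    using right_alt_linearized[of u v e] by (simp add: S)
  show "mul v u = 0"
    using right_alt_linearized[of v u e] by (auto simp: S)
  show "\<exists>p q. mul u u = lc e u v p q 0"
    using right_alt_linearized[of u u e] by (simp add: S)
  have "s1 = 0 \<and> s2 = 0"
    using right_alt_linearized[of e v v] by (simp add: S)
  then show "\<exists>r. mul v v = scl r v"
    by (auto simp: s lc_def)
qed

text \<open>The span of \<open>e\<close>, \<open>u\<close> and the line of \<open>v\<close> are
  complementary ideals. The former is normalized by \<open>unital_plane\<close>, the latter has zero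
  product or is a copy of the complex numbers, so there are four outcomes.\<close>

lemma listed_peirce_20:
  assumes B: "basis3 e u v" and ee: "mul e e = e" and eu: "mul e u = u" "mul u e = u"
    and ev: "mul e v = 0" "mul v e = 0"
  shows listed
proof -
  note * = peirce_20_products[OF assms]
  obtain p q where "mul u u = lc e u v p q 0" using *(3) by blast
  then obtain n where n: "basis3 e n v" "mul e n = n" "mul n e = n" "mul n n = 0 \<or> mul n n = n"
    using unital_plane[OF B ee eu] by metis
  note ** = peirce_20_products[OF n(1) ee n(2,3) ev]
  obtain r where r: "mul v v = scl r v" using **(4) by blast
  have P: "mul e e = lc e n v 1 0 0" "mul e n = lc e n v 0 1 0" "mul n e = lc e n v 0 1 0"
    "mul v v = lc e n v 0 0 r"
    using ee n(2,3) r by (simp_all add: lc_unit) (simp add: lc_def)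
  note S = P **(1,2) ev lc_simps lc_eq_iff[OF n(1)] lc_eq_0_iff[OF n(1)] table_simps
  consider "mul n n = 0" "r = 0" | "mul n n = 0" "r \<noteq> 0" | "mul n n = lc e n v 0 1 0" "r = 0"
    | "mul n n = lc e n v 0 1 0" "r \<noteq> 0"
    using n(4) by (auto simp: lc_unit)
  then show ?thesis
  proof cases
    case 1
    show ?thesis
      by (rule listedI[where X = A02 and x = "lc e n v 1 0 0" and y = "lc e n v 0 1 0"
            and z = "lc e n v 0 0 1", OF _ _ refl]) (simp_all add: basis3_def S 1)
  next
    case 2
    then show ?thesis
      by (intro listedI[where X = A08 and x = "lc e n v 0 0 (1 / r)" and y = "lc e n v 1 0 0"
            and z = "lc e n v 0 1 0", OF _ _ refl]) (simp_all add: basis3_def S)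
  next
    case 3
    show ?thesis
      by (rule listedI[where X = A01 and x = "lc e n v 0 1 0" and y = "lc e n v 1 (-1) 0"
            and z = "lc e n v 0 0 1", OF _ _ refl]) (simp_all add: basis3_def S 3)
  next
    case 4
    then show ?thesis
      by (intro listedI[where X = A07 and x = "lc e n v 0 1 0" and y = "lc e n v 1 (-1) 0"
            and z = "lc e n v 0 0 (1 / r)", OF _ _ refl]) (simp_all add: basis3_def S)
  qed
qed

text \<open>Here right multiplication by \<open>e\<close> fixes \<open>u\<close> up to the component
  \<open>c v\<close> in \<open>J_0\<close>. The identity forces \<open>c = 0\<close> unless
  \<open>v\<close> has square zero and \<open>v u = 0\<close>.\<close>

lemma listed_peirce_10_left:
  assumes B: "basis3 e u v" and ee: "mul e e = e" and eu: "mul e u = lc e u v 0 0 (- c)"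
    and ue: "mul u e = lc e u v 0 1 c" and ev: "mul e v = 0" "mul v e = 0"
  shows listed
proof -
  obtain p1 p2 p3 where p: "mul u u = lc e u v p1 p2 p3" using basis3_span[OF B] by blast
  obtain q1 q2 q3 where q: "mul u v = lc e u v q1 q2 q3" using basis3_span[OF B] by blast
  obtain r1 r2 r3 where r: "mul v u = lc e u v r1 r2 r3" using basis3_span[OF B] by blast
  obtain s1 s2 s3 where s: "mul v v = lc e u v s1 s2 s3" using basis3_span[OF B] by blast
  have ee': "mul e e = lc e u v 1 0 0" using ee by (simp add: lc_unit)
  note S = ee' eu ue p q r s ev lc_simps lc_eq_iff[OF B] lc_eq_0_iff[OF B] complex_add_self_eq_0
  have s12: "s1 = 0" "s2 = 0"
    using right_alt_linearized[of v v e] right_alt_linearized[of e v v] by (auto simp: S)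
  have q1: "q1 = 0" "q2 = 0" using right_alt_linearized[of u v e] s12 by (auto simp: S)
  then have q3: "q3 = - c * s3" using right_alt_linearized[of u v e] s12 by (simp add: S) algebra
  have r3: "r3 = c * r2" using right_alt_linearized[of v u e] by (auto simp: S mult.commute)
  have r1: "r1 = 0" "c * r2 = c * s3"
    using right_alt_linearized[of e u v] s12 q1 q3 r3 by (auto simp: S)
  have p12: "p1 = 0" "p2 = - c * r2"
    using right_alt_linearized[of u u e] s12 q1 q3 r3 r1 by (auto simp: S eq_neg_iff_add_eq_0)
  have cr: "c * r2 = 0"
    using right_alt_linearized[of e u u] p12 r3 r1 by (auto simp: S)
  then have cs: "c * s3 = 0" using r1 by simp
  have C: "c = 0 \<or> r2 = 0" "c = 0 \<or> s3 = 0" using cr cs by auto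
  have ps: "p3 * s3 = 0" "p3 * r2 = 0"
    using right_alt_linearized[of v u u] right_alt_linearized[of u u u] s12 q1 q3 r3 r1 p12 C by (auto simp: S)
  have rs: "r2 = 0 \<or> r2 = s3"
    using right_alt_linearized[of v u v] s12 q1 q3 r3 r1 p12 C by (auto simp: S)
  show ?thesis
  proof (cases "s3 = 0")
    case False
    then have "c = 0" "p3 = 0" using C ps by auto
    then have U: "mul e u = 0" "mul u e = lc e u v 0 1 0" "mul u u = 0" "mul u v = 0"
      "mul v u = lc e u v 0 r2 0" "mul v v = lc e u v 0 0 s3"
      using s12 q1 q3 r3 r1 p12 by (simp_all add: S)
    note S' = ee' U ev lc_simps lc_eq_iff[OF B] lc_eq_0_iff[OF B] table_simps basis3_def
    show ?thesis
    proof (cases "r2 = 0")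
      case True
      with False show ?thesis
        by (intro listedI[where X = R16 and x = "lc e u v 1 0 0" and y = "lc e u v 0 0 (1 / s3)"
            and z = "lc e u v 0 1 0", OF _ _ refl]) (simp_all add: S')
    next
      case r: False
      then have "r2 = s3" using rs by simp
      \<comment> \<open>\<open>R11\<close> arises here and in \<open>listed_peirce_10_right\<close>:
        its idempotents \<open>e1\<close> and \<open>e2\<close> act as identity on \<open>e3\<close>
        from the left and from the right, respectively.\<close>
      with False show ?thesis
        by (intro listedI[where X = R11 and x = "lc e u v 0 0 (1 / s3)" and y = "lc e u v 1 0 0"
            and z = "lc e u v 0 1 0", OF _ _ refl]) (simp_all add: S')
    qed
  next
    case s0: True
    then have "r2 = 0" using rs by auto
    then have U: "mul u u = lc e u v 0 0 p3" "mul u v = 0" "mul v u = 0" "mul v v = 0"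
      using s12 q1 q3 r3 r1 p12 s0 by (simp_all add: S)
    note S' = ee' eu ue U ev lc_simps lc_eq_iff[OF B] lc_eq_0_iff[OF B] table_simps basis3_def
    consider "p3 \<noteq> 0" | "p3 = 0" "c \<noteq> 0" | "p3 = 0" "c = 0" by blast
    then show ?thesis
    proof cases
      case 1
      \<comment> \<open>For every \<open>t\<close> the element \<open>e + t u + t^2 u u\<close> is
        idempotent, where \<open>u u = p3 v\<close>. This value of \<open>t\<close> makes it
        annihilate \<open>u + 2 c v\<close> from the left, which removes \<open>c\<close>.\<close>
      define t where "t = c / p3"
      have c: "c = t * p3" using 1 by (simp add: t_def)
      from 1 show ?thesis
        by (intro listedI[where X = R09 and x = "lc e u v 1 t (t * t * p3)"
            and y = "lc e u v 0 1 (2 * t * p3)" and z = "lc e u v 0 0 p3", OF _ _ refl])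
          (simp_all add: S' c algebra_simps)
    next
      case 2
      then show ?thesis
        by (intro listedI[where X = R13 and x = "lc e u v 1 0 0" and y = "lc e u v 0 1 0"
            and z = "lc e u v 0 0 (- c)", OF _ _ refl]) (simp_all add: S')
    next
      case 3
      then show ?thesis
        by (intro listedI[where X = R12 and x = "lc e u v 1 0 0" and y = "lc e u v 0 1 0"
            and z = "lc e u v 0 0 1", OF _ _ refl]) (simp_all add: S')
    qed
  qed
qed

lemma listed_peirce_10_right:
  assumes B: "basis3 e u v" and ee: "mul e e = e" and eu: "mul e u = lc e u v (- a) 1 0"
    and ue: "mul u e = lc e u v a 0 0" and ev: "mul e v = 0" "mul v e = 0"
  shows listed
proof -
  obtain p1 p2 p3 where p: "mul u u = lc e u v p1 p2 p3" using basis3_span[OF B] by blast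
  obtain q1 q2 q3 where q: "mul u v = lc e u v q1 q2 q3" using basis3_span[OF B] by blast
  obtain r1 r2 r3 where r: "mul v u = lc e u v r1 r2 r3" using basis3_span[OF B] by blast
  obtain s1 s2 s3 where s: "mul v v = lc e u v s1 s2 s3" using basis3_span[OF B] by blast
  have ee': "mul e e = lc e u v 1 0 0" using ee by (simp add: lc_unit)
  note S = ee' eu ue p q r s ev lc_simps lc_eq_iff[OF B] lc_eq_0_iff[OF B] complex_add_self_eq_0
  have s12: "s1 = 0" "s2 = 0"
    using right_alt_linearized[of v v e] right_alt_linearized[of e v v] by (auto simp: S)
  have q1: "q1 = - a * q2" using right_alt_linearized[of u v e] by (simp add: S) algebra
  have r23: "r2 = 0" "r3 = 0" using right_alt_linearized[of v u e] by (auto simp: S)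
  have p23: "p3 = 0" "p2 = a" using right_alt_linearized[of u u e] by (auto simp: S)
  have a: "a = 0" using right_alt_linearized[of e u u] p23 by (simp add: S)
  have q3: "q3 = 0" and r1: "r1 = 0"
    using right_alt_linearized[of e u v] q1 r23 a by (auto simp: S)
  have p1: "p1 = 0" using right_alt_linearized[of u u u] p23 a by (auto simp: S)
  have qs: "q2 = 0 \<or> q2 = s3"
    using right_alt_linearized[of u v v] s12 q1 q3 r1 a by (auto simp: S)
  have U: "mul e u = lc e u v 0 1 0" "mul u e = 0" "mul u u = 0" "mul v u = 0"
    "mul u v = lc e u v 0 q2 0" "mul v v = lc e u v 0 0 s3"
    using s12 q1 q3 r1 r23 p1 p23 a by (simp_all add: S)
  note S' = ee' U ev lc_simps lc_eq_iff[OF B] lc_eq_0_iff[OF B] table_simps basis3_def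
  consider "s3 = 0" "q2 = 0" | "s3 \<noteq> 0" "q2 = 0" | "s3 \<noteq> 0" "q2 = s3" using qs by blast
  then show ?thesis
  proof cases
    case 1
    then show ?thesis
      by (intro listedI[where X = R14 and x = "lc e u v 1 0 0" and y = "lc e u v 0 1 0"
          and z = "lc e u v 0 0 1", OF _ _ refl]) (simp_all add: S')
  next
    case 2
    then show ?thesis
      by (intro listedI[where X = R15 and x = "lc e u v 1 0 0" and y = "lc e u v 0 0 (1 / s3)"
          and z = "lc e u v 0 1 0", OF _ _ refl]) (simp_all add: S')
  next
    case 3
    then show ?thesis
      by (intro listedI[where X = R11 and x = "lc e u v 1 0 0" and y = "lc e u v 0 0 (1 / s3)"
          and z = "lc e u v 0 1 0", OF _ _ refl]) (simp_all add: S')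
  qed
qed

text \<open>Idempotency of right multiplication by \<open>e\<close> forces the coefficient
  \<open>b\<close> to be 0 or 1; the first value kills \<open>c\<close>, the second kills
  \<open>a\<close>.\<close>

lemma listed_peirce_10:
  assumes B: "basis3 e u v" and ee: "mul e e = e" and u: "peirce e 1 u"
    and ev: "mul e v = 0" "mul v e = 0"
  shows listed
proof -
  obtain a b c where ue: "mul u e = lc e u v a b c" using basis3_span[OF B] by blast
  have ee': "mul e e = lc e u v 1 0 0" using ee by (simp add: lc_unit)
  have eu: "mul e u = lc e u v (- a) (1 - b) (- c)"
  proof -
    have "mul e u = lc e u v 0 1 0 - lc e u v a b c"
      using u by (simp add: peirce_def lc_unit eq_diff_eq flip: ue)
    then show ?thesis by (simp add: lc_diff)
  qed
  note S = ee' ue lc_simps lc_eq_iff[OF B] ev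
  have "a + b * a = a \<and> b * b = b \<and> b * c = c"
    using right_alt_square[of u e] by (simp add: S ee)
  then consider "b = 0" "c = 0" | "b = 1" "a = 0" by auto
  then show ?thesis
  proof cases
    case 1
    with ue eu show ?thesis by (intro listed_peirce_10_right[OF B ee _ _ ev]) auto
  next
    case 2
    with ue eu show ?thesis by (intro listed_peirce_10_left[OF B ee _ _ ev]) auto
  qed
qed

section \<open>Powers of an element\<close>

text \<open>\<open>ev x p\<close> is the value at \<open>x\<close> of the polynomial \<open>X p\<close>, which has no constant term.\<close>

definition ev :: "'a \<Rightarrow> complex poly \<Rightarrow> 'a" where
  "ev x p = fold_coeffs (\<lambda>a v. scl a x + mul v x) p 0"

lemma ev_0 [simp]: "ev x 0 = 0"
  by (simp add: ev_def)

lemma ev_pCons: "ev x (pCons a p) = scl a x + mul (ev x p) x"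
  by (cases "p = 0 \<and> a = 0") (auto simp: ev_def)

lemma ev_add: "ev x (p + q) = ev x p + ev x q"
proof (induction p arbitrary: q)
  case (pCons a p)
  obtain b r where q: "q = pCons b r" by (cases q)
  have "ev x (pCons a p + q) = scl (a + b) x + mul (ev x p + ev x r) x"
    by (simp add: q ev_pCons pCons.IH)
  also have "\<dots> = ev x (pCons a p) + ev x q"
    by (simp add: q ev_pCons scale_left_distrib mul_add_left)
  finally show ?case .
qed simp

lemma ev_smult: "ev x (smult c p) = scl c (ev x p)"
  by (induction p) (simp_all add: ev_pCons scale_right_distrib mul_scale_left)

lemma ev_diff: "ev x (p - q) = ev x p - ev x q"
  using ev_add[of x "p - q" q] by (simp add: algebra_simps)

text \<open>The three claims need a joint induction: if \<open>x\<close> commutes with E and the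
  right multiplications by \<open>x\<close> and by E commute, then the linearized identity for y, E,
  x becomes 2 y(Ex) = 2 (yE)x.\<close>

lemma mul_ev_commute_all:
  "mul x (ev x q) = mul (ev x q) x \<and> (\<forall>y. mul y (mul (ev x q) x) = mul (mul y (ev x q)) x
    \<and> mul (mul y x) (ev x q) = mul (mul y (ev x q)) x)"
proof (induction q)
  case (pCons b q)
  let ?E = "ev x (pCons b q)"
  have IH: "mul x (ev x q) = mul (ev x q) x" "mul y (mul (ev x q) x) = mul (mul y (ev x q)) x"
    "mul (mul y x) (ev x q) = mul (mul y (ev x q)) x" for y
    using pCons.IH by auto
  have 1: "mul x ?E = mul ?E x"
    by (simp add: ev_pCons mul_add_left mul_add_right mul_scale_left mul_scale_right IH)
  have 3: "mul (mul z x) ?E = mul (mul z ?E) x" for z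
    by (simp add: ev_pCons mul_add_left mul_add_right mul_scale_left mul_scale_right IH)
  have "scl 2 (mul y (mul ?E x)) = scl 2 (mul (mul y ?E) x)" for y
    using right_alt_linearized[of y ?E x]
    by (simp add: 1 3 scale_left_distrib[of 1 1, simplified])
  with 1 3 show ?case by simp
qed simp

lemma mul_ev_commute:
  "mul x (ev x q) = mul (ev x q) x"
  "mul y (mul (ev x q) x) = mul (mul y (ev x q)) x"
  "mul (mul y x) (ev x q) = mul (mul y (ev x q)) x"
  using mul_ev_commute_all by blast+

text \<open>The extra factor X comes from the convention that \<open>p\<close> stands for the
  polynomial Xp: the product of Xp and Xq is X(Xpq).\<close>

lemma mul_ev_ev: "mul (ev x p) (ev x q) = ev x (pCons 0 (p * q))"
proof (induction q)
  case (pCons b q)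
  then show ?case
    by (simp add: ev_pCons mul_add_right mul_scale_right mul_ev_commute(2) ev_add ev_smult
        mul_add_left mul_scale_left)
qed simp

lemma ev_closed:
  assumes S: "subspace S" "\<And>y z. y \<in> S \<Longrightarrow> z \<in> S \<Longrightarrow> mul y z \<in> S" and x: "x \<in> S"
  shows "ev x p \<in> S"
proof (induction p)
  case 0
  show ?case using S(1) by (simp add: subspace_0)
next
  case (pCons a p)
  then show ?case using S x by (simp add: ev_pCons subspace_add subspace_scale)
qed

lemma ev_annihilated: "mul z x = 0 \<Longrightarrow> mul z (ev x p) = 0"
  by (induction p) (simp_all add: ev_pCons mul_add_right mul_scale_right mul_ev_commute(2))

text \<open>The polynomials killing \<open>x\<close> form an ideal. Multiplication in the algebra
  provides only cofactors divisible by X, so the constant term of the cofactor is split off and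
  treated as a scalar.\<close>

lemma ev_dvd:
  assumes "ev x p = 0" "p dvd q"
  shows "ev x q = 0"
proof -
  obtain r where "q = p * r" using assms(2) by (auto simp: dvd_def)
  then show ?thesis
    using assms(1) mul_ev_ev[of x p]
    by (cases r) (simp add: ev_add ev_smult)
qed

text \<open>Four powers of \<open>x\<close> are linearly dependent in dimension 3.\<close>

lemma ev_eq_0_exists: obtains p where "p \<noteq> 0" "ev x p = 0"
proof (cases "basis3 x (mul x x) (mul (mul x x) x)")
  case True
  obtain a b c where "mul (mul (mul x x) x) x = lc x (mul x x) (mul (mul x x) x) a b c"
    using basis3_span[OF True] by blast
  then have "ev x [:- a, - b, - c, 1:] = 0"
    by (simp add: ev_pCons lc_def mul_add_left mul_diff_left mul_scale_left algebra_simps)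
  then show ?thesis by (intro that[of "[:- a, - b, - c, 1:]"]) auto
next
  case False
  then obtain a b c where "lc x (mul x x) (mul (mul x x) x) a b c = 0"
    and nz: "\<not> (a = 0 \<and> b = 0 \<and> c = 0)"
    unfolding basis3_def by blast
  then have "ev x [:a, b, c:] = 0"
    by (simp add: ev_pCons lc_def mul_add_left mul_diff_left mul_scale_left algebra_simps)
  then show ?thesis by (rule that[rotated]) (use nz in auto)
qed

text \<open>A polynomial killing \<open>x\<close> can be taken of the form \<open>X\<^sup>m (1 - X h)\<close>, up to an invertible constant;
  then \<open>X h\<close> acts as the identity on the multiples of \<open>X\<^sup>m\<close>.\<close>

lemma ev_eq_0_split:
  assumes p: "p \<noteq> 0" "ev x p = 0"
  obtains h where "ev x (monom 1 (order 0 p) * (1 - pCons 0 h)) = 0"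
proof -
  obtain g where g: "p = [:0, 1:] ^ order 0 p * g" "\<not> [:0, 1:] dvd g"
    using order_decomp[OF p(1), of 0] by auto
  obtain g0 g1 where gg: "g = pCons g0 g1" by (cases g)
  have "g0 \<noteq> 0" using g(2) gg by (auto simp: dvd_def) 
  define h where "h = smult (- 1 / g0) g1"
  have "g = smult g0 (1 - pCons 0 h)"
    using \<open>g0 \<noteq> 0\<close> by (simp add: gg h_def one_pCons)
  then have "p = smult g0 (monom 1 (order 0 p) * (1 - pCons 0 h))"
    using g(1) by (simp add: monom_altdef)
  then have "scl g0 (ev x (monom 1 (order 0 p) * (1 - pCons 0 h))) = 0"
    using p(2) by (metis ev_smult)
  then show ?thesis using that \<open>g0 \<noteq> 0\<close> by simp
qed

lemma one_minus_dvd_one_minus_power: "(1 - a :: 'b::comm_ring_1) dvd 1 - a ^ n"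
  using power_diff_1_eq[of a n] by (metis dvd_triv_left minus_diff_eq minus_dvd_iff dvd_minus_iff)

text \<open>Modulo the ideal of polynomials killing \<open>x\<close>, the polynomial Xh is 1 on
  multiples of X^m, and so are its powers, because 1 - Xh divides 1 - (Xh)^n.\<close>

lemma ev_monom_power:
  assumes "ev x (monom 1 m * (1 - pCons 0 h)) = 0"
  shows "ev x (monom 1 m * q) = ev x (monom 1 m * (pCons 0 h) ^ n * q)"
proof -
  have "monom 1 m * (1 - pCons 0 h) dvd monom 1 m * q - monom 1 m * (pCons 0 h) ^ n * q"
    using mult_dvd_mono[OF dvd_refl[of "monom 1 m"] dvd_mult2[OF one_minus_dvd_one_minus_power[of "pCons 0 h" n], of q]]
    by (simp add: algebra_simps)
  from ev_dvd[OF assms this] show ?thesis by (simp add: ev_diff)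
qed

text \<open>Note the shift: \<open>ev x (monom 1 k)\<close> is the power of \<open>x\<close> with
  exponent \<open>k + 1\<close>.\<close>

definition nilpotent :: "'a \<Rightarrow> bool" where
  "nilpotent x \<longleftrightarrow> (\<exists>k. ev x (monom 1 k) = 0)"

text \<open>The idempotent is the one that splits off the nilpotent part of multiplication by
  \<open>x\<close>, written as a polynomial in \<open>x\<close> without constant term.\<close>

lemma idempotent_of_not_nilpotent:
  assumes "\<not> nilpotent x"
  obtains q where "ev x q \<noteq> 0" "mul (ev x q) (ev x q) = ev x q"
proof -
  obtain p where p: "p \<noteq> 0" "ev x p = 0" by (rule ev_eq_0_exists)
  obtain h where h: "ev x (monom 1 (order 0 p) * (1 - pCons 0 h)) = 0" using ev_eq_0_split[OF p] by blast
  define m where "m = order 0 p"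
  \<comment> \<open>Chosen so that XF = (Xh)^(m+1), which acts as identity on multiples of X^m. As F
    is itself such a multiple, its value is idempotent; if the value were 0, so would be that of
    X^m.\<close>
  define F where "F = monom 1 m * h ^ Suc m"
  have XF: "pCons 0 F = pCons 0 h ^ Suc m"
  proof -
    have "pCons 0 F = [:0, 1:] * F" by simp
    also have "\<dots> = ([:0, 1:] * h) ^ Suc m"
      by (simp only: F_def monom_altdef power_mult_distrib power_Suc smult_1_left mult_ac)
    finally show ?thesis by simp
  qed
  note * = ev_monom_power[OF h[folded m_def], of _ "Suc m"]
  have "ev x F = ev x (monom 1 m * pCons 0 F * h ^ Suc m)"
    unfolding XF by (subst F_def) (rule *)
  also have "monom 1 m * pCons 0 F * h ^ Suc m = pCons 0 (F * F)"
    by (simp add: F_def algebra_simps)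
  finally have "mul (ev x F) (ev x F) = ev x F" by (metis mul_ev_ev)
  moreover have "ev x F \<noteq> 0"
  proof
    assume 0: "ev x F = 0"
    have "ev x (monom 1 m) = ev x (monom 1 m * pCons 0 F)"
      unfolding XF using *[of 1] by simp
    also have "\<dots> = mul (ev x (monom 1 m)) (ev x F)" by (simp add: mul_ev_ev)
    finally show False using assms 0 by (auto simp: nilpotent_def)
  qed
  ultimately show ?thesis using that by blast
qed

text \<open>With d the order of \<open>p\<close> at 0, the polynomial X^d is congruent to X^d (Xh)^k
  for every k, which is divisible by X^k and hence kills a nilpotent \<open>x\<close> for large k. A
  nonzero coefficient at \<open>m\<close> means that d \<le> m.\<close>

lemma nilpotent_ev_eq_0:
  assumes nil: "nilpotent x" and p: "ev x p = 0" "coeff p m \<noteq> 0"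
  shows "ev x (monom 1 m) = 0"
proof -
  have "p \<noteq> 0" using p by auto
  then obtain h where h: "ev x (monom 1 (order 0 p) * (1 - pCons 0 h)) = 0"
    using ev_eq_0_split p by blast
  obtain k where k: "ev x (monom 1 k) = 0" using nil by (auto simp: nilpotent_def)
  have "pCons 0 h = monom 1 1 * h" by (simp add: monom_altdef)
  then have "pCons 0 h ^ k = monom 1 k * h ^ k" by (simp add: power_mult_distrib monom_power)
  then have "monom 1 k dvd monom 1 (order 0 p) * pCons 0 h ^ k * 1" by simp
  then have "ev x (monom 1 (order 0 p) * 1) = 0"
    using ev_monom_power[OF h, of 1 k] ev_dvd[OF k] by metis
  moreover have "order 0 p \<le> m"
  proof (rule ccontr)
    assume "\<not> order 0 p \<le> m"
    then have "monom 1 (Suc m) dvd p"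
      using order_divides[of 0 "Suc m" p] by (simp add: monom_altdef)
    then show False using p(2) by (simp add: monom_1_dvd_iff')
  qed
  then have "monom 1 (order 0 p) dvd (monom 1 m :: complex poly)"
    by (simp add: monom_altdef le_imp_power_dvd)
  ultimately show ?thesis using ev_dvd by simp
qed

lemma ev_monom_small:
  "ev x (monom 1 0) = x" "ev x (monom 1 1) = mul x x"
  "ev x (monom 1 2) = mul (mul x x) x" "ev x (monom 1 3) = mul (mul (mul x x) x) x"
  by (simp_all add: monom_altdef ev_pCons numeral_eq_Suc one_pCons)

text \<open>A relation with a nonzero coefficient of index at most 2 would make the cube vanish, so
  the three powers are independent. The relation expressing the fourth power has coefficient 1 at
  index 3, which makes that power vanish.\<close>

lemma nilpotent_cube_basis:
  assumes nil: "nilpotent x" and cube: "mul (mul x x) x \<noteq> 0"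
  shows "basis3 x (mul x x) (mul (mul x x) x)" "mul (mul (mul x x) x) x = 0"
proof -
  have 2: "ev x (monom 1 2) \<noteq> 0" using cube by (simp add: ev_monom_small)
  have "m \<le> 2 \<Longrightarrow> ev x (monom 1 m) \<noteq> 0" for m
    using 2 ev_dvd[of x "monom 1 m" "monom 1 2"] by (auto simp: monom_altdef le_imp_power_dvd)
  then have *: "coeff p m = 0" if "ev x p = 0" "m \<le> 2" for p m
    using nilpotent_ev_eq_0[OF nil that(1)] that(2) by blast
  show B: "basis3 x (mul x x) (mul (mul x x) x)"
    unfolding basis3_def
  proof (intro allI impI)
    fix a b c assume "lc x (mul x x) (mul (mul x x) x) a b c = 0"
    then have "ev x [:a, b, c:] = 0"
      by (simp add: ev_pCons lc_def mul_add_left mul_diff_left mul_scale_left algebra_simps)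
    from *[OF this, of 0] *[OF this, of 1] *[OF this, of 2] show "a = 0 \<and> b = 0 \<and> c = 0"
      by (simp add: numeral_eq_Suc)
  qed
  obtain a b c where "mul (mul (mul x x) x) x = lc x (mul x x) (mul (mul x x) x) a b c"
    using basis3_span[OF B] by blast
  then have "ev x [:- a, - b, - c, 1:] = 0"
    by (simp add: ev_pCons lc_def mul_add_left mul_diff_left mul_scale_left algebra_simps)
  moreover have "coeff [:- a, - b, - c, 1:] 3 \<noteq> 0" by (simp add: numeral_eq_Suc)
  ultimately have "ev x (monom 1 3) = 0" by (rule nilpotent_ev_eq_0[OF nil])
  then show "mul (mul (mul x x) x) x = 0"
    using ev_monom_small(4)[of x] by simp
qed

lemma nilpotent_square_independent:
  assumes nil: "nilpotent x" and sq: "mul x x \<noteq> 0" and z: "scl a x + scl b (mul x x) = 0"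
  shows "a = 0" "b = 0"
proof -
  have e: "ev x [:a, b:] = 0" using z by (simp add: ev_pCons mul_add_left mul_scale_left)
  have "x \<noteq> 0" using sq by auto
  then show "a = 0" "b = 0"
    using nilpotent_ev_eq_0[OF nil e, of 0] nilpotent_ev_eq_0[OF nil e, of 1] sq
    by (auto simp: ev_monom_small(1,2)[simplified])
qed

section \<open>Idempotents with a two-dimensional \<open>J_0\<close>\<close>

context
  fixes e u v
  assumes B: "basis3 e u v" and ee: "mul e e = e"
    and eu: "mul e u = 0" "mul u e = 0" and ev: "mul e v = 0" "mul v e = 0"
begin

text \<open>This is the space \<open>J_0\<close> of \<open>e\<close>, an ideal complementary to the
  line of \<open>e\<close>; what remains is to classify it as a two-dimensional algebra.\<close>

definition complement :: "'a set" where "complement = {lc e u v 0 b c |b c. True}"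

lemma complementI: "lc e u v 0 b c \<in> complement"
  by (auto simp: complement_def)

lemma complement_basis: "u \<in> complement" "v \<in> complement"
  using complementI[of 1 0] complementI[of 0 1] by (simp_all add: lc_unit)

lemma complement_mul_0: "x \<in> complement \<Longrightarrow> mul e x = 0" "x \<in> complement \<Longrightarrow> mul x e = 0"
  by (auto simp: complement_def mul_lc_left mul_lc_right eu ev)

lemma in_complementI: "mul x e = 0 \<Longrightarrow> x \<in> complement"
proof -
  assume 0: "mul x e = 0"
  obtain a b c where x: "x = lc e u v a b c" using basis3_span[OF B] by blast
  have "lc e u v a 0 0 = 0" using 0 by (simp add: x mul_lc_left ee eu ev) (simp add: lc_def)
  then show ?thesis using lc_eq_0_iff[OF B] by (simp add: x complementI)
qed

lemma complement_subspace: "subspace complement"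
  by (rule subspaceI)
    (auto simp: complement_def lc_add lc_scale, metis lc_zero, auto)

lemma complement_mul: "x \<in> complement \<Longrightarrow> y \<in> complement \<Longrightarrow> mul x y \<in> complement"
  using right_alt_linearized[of x y e] by (intro in_complementI) (simp add: complement_mul_0)

lemma idem_not_in_complement: "e \<notin> complement"
proof
  assume "e \<in> complement"
  then have "e = 0" using complement_mul_0(1) ee by force
  then show False using lc_eq_0_iff[OF B, of 1 0 0] by (simp add: lc_unit)
qed

text \<open>Both \<open>e\<close> and \<open>f\<close> are available, and \<open>e\<close> lies in
  the 0-space of \<open>f\<close>. Hence \<open>f\<close> has a nonzero \<open>J_0\<close>, and a
  further vector of the complement can be taken in one Peirce space of \<open>f\<close>; if that is
  \<open>J_1\<close> or \<open>J_2\<close>, the case of a one-dimensional \<open>J_0\<close> applies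
  to \<open>f\<close>.\<close>

lemma listed_complement_idempotent:
  assumes f: "f \<in> complement" "f \<noteq> 0" "mul f f = f"
  shows listed
proof -
  obtain b c where fbc: "f = lc e u v 0 b c" using f(1) by (auto simp: complement_def)
  have "\<exists>w\<in>complement. basis3 e f w"
  proof (cases "c = 0")
    case True
    then have "b \<noteq> 0" using f(2) by (auto simp: fbc lc_zero)
    have "basis3 (lc e u v 1 0 0) f (lc e u v 0 0 1)"
      unfolding basis3_def fbc lc_nested using \<open>b \<noteq> 0\<close> True by (simp add: lc_eq_0_iff[OF B])
    then show ?thesis using complement_basis by (auto simp: lc_unit)
  next
    case False
    have "basis3 (lc e u v 1 0 0) f (lc e u v 0 1 0)"
      unfolding basis3_def fbc lc_nested using False by (auto simp: lc_eq_0_iff[OF B])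
    then show ?thesis using complement_basis by (auto simp: lc_unit)
  qed
  then obtain w where w: "w \<in> complement" and W: "basis3 e f w" by blast
  \<comment> \<open>The Peirce components of \<open>w\<close> with respect to \<open>f\<close>. They
    stay in the complement because it is a subalgebra containing \<open>f\<close> and
    \<open>w\<close>.\<close>
  define w2 where "w2 = mul (mul f w) f"
  define w1 where "w1 = mul f w + mul w f - scl 2 w2"
  define w0 where "w0 = w - (mul f w + mul w f) + w2"
  note closed = subspace_add[OF complement_subspace] subspace_diff[OF complement_subspace]
    subspace_scale[OF complement_subspace] complement_mul f(1) w
  have mem: "w0 \<in> complement" "w1 \<in> complement" "w2 \<in> complement"
    unfolding w0_def w1_def w2_def by (intro closed)+
  have dec: "w = w0 + w1 + w2" and p: "peirce f 0 w0" "peirce f 1 w1" "peirce f 2 w2"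
    using peirce_decomposition[OF f(3), of w] unfolding w0_def w1_def w2_def by auto
  have alt: "(\<exists>k. x = scl k f) \<or> basis3 e f x" if x: "x \<in> complement" for x
  proof -
    obtain a b c where abc: "x = lc e f w a b c" using basis3_span[OF W] by blast
    have "lc e f w a 0 0 = mul e x"
      by (simp add: abc mul_lc_right ee complement_mul_0 f(1) w) (simp add: lc_def)
    then have "a = 0" using lc_eq_0_iff[OF W] complement_mul_0(1)[OF x] by simp
    show ?thesis
    proof (cases "c = 0")
      case True
      then show ?thesis using abc \<open>a = 0\<close> by (auto simp: lc_def)
    next
      case False
      have "basis3 (lc e f w 1 0 0) (lc e f w 0 1 0) x"
        unfolding basis3_def abc lc_nested using False by (simp add: lc_eq_0_iff[OF W])
      then show ?thesis by (simp add: lc_unit)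
    qed
  qed
  have fe: "mul f e = 0" "mul e f = 0" using complement_mul_0 f(1) by auto
  consider "basis3 e f w0" | "basis3 e f w1" | "basis3 e f w2"
    | k0 k1 k2 where "w0 = scl k0 f" "w1 = scl k1 f" "w2 = scl k2 f"
    using alt mem by blast
  then show ?thesis
  proof cases
    case 1
    note C = 1
    have w0: "mul f w0 = 0" "mul w0 f = 0" using peirce_0_D[OF f(3) p(1)] by auto
    have ew0: "mul e w0 = 0" "mul w0 e = 0" using complement_mul_0 mem(1) by auto
    obtain a b c where abc: "mul w0 w0 = lc e f w0 a b c" using basis3_span[OF C] by blast
    have "lc e f w0 a 0 0 = mul e (mul w0 w0)"
      unfolding abc by (simp add: mul_lc_right ee fe ew0) (simp add: lc_def)
    then have "a = 0" using complement_mul_0(1)[OF complement_mul[OF mem(1) mem(1)]]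
      by (simp add: lc_eq_0_iff[OF C])
    have "lc e f w0 0 b 0 = mul (mul w0 w0) f"
      unfolding abc by (simp add: mul_lc_left f(3) fe w0) (simp add: lc_def)
    also have "\<dots> = 0" using right_alt_linearized[of w0 w0 f] by (simp add: w0)
    finally have "b = 0" by (simp add: lc_eq_0_iff[OF C])
    have P: "mul e e = lc e f w0 1 0 0" "mul f f = lc e f w0 0 1 0"
      "mul w0 w0 = lc e f w0 0 0 c"
      using abc \<open>a = 0\<close> \<open>b = 0\<close> ee f(3) by (simp_all add: lc_unit)
    note S = P fe w0 ew0 lc_simps lc_eq_iff[OF C] lc_eq_0_iff[OF C] table_simps basis3_def
    show ?thesis
    proof (cases "c = 0")
      case True
      then show ?thesis
        by (intro listedI[where X = A01 and x = "lc e f w0 1 0 0" and y = "lc e f w0 0 1 0"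
            and z = "lc e f w0 0 0 1", OF _ _ refl]) (simp_all add: S)
    next
      case False
      then show ?thesis
        by (intro listedI[where X = A07 and x = "lc e f w0 1 0 0" and y = "lc e f w0 0 1 0"
            and z = "lc e f w0 0 0 (1 / c)", OF _ _ refl]) (simp_all add: S)
    qed
  next
    case 2
    show ?thesis by (rule listed_peirce_10[OF basis3_rotate[OF 2] f(3) p(2) fe])
  next
    case 3
    show ?thesis
      by (rule listed_peirce_20[OF basis3_rotate[OF 3] f(3) peirce_2_D[OF f(3) p(3)] fe])
  next
    \<comment> \<open>If all components were multiples of \<open>f\<close>, so would be
      \<open>w\<close>.\<close>
    case 4
    then have "lc e f w 0 (- (k0 + k1 + k2)) 1 = 0"
      using dec by (simp add: lc_def algebra_simps)
    then show ?thesis by (simp add: lc_eq_0_iff[OF W])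
  qed
qed

lemma listed_complement_nil:
  assumes nil: "\<And>x. x \<in> complement \<Longrightarrow> nilpotent x"
  shows listed
proof (cases "\<exists>x\<in>complement. mul x x \<noteq> 0")
  case True
  then obtain x where x: "x \<in> complement" and sq: "mul x x \<noteq> 0" by blast
  have xx: "mul x x \<in> complement" by (rule complement_mul[OF x x])
  have cube: "mul (mul x x) x = 0"
  proof (rule ccontr)
    assume c: "mul (mul x x) x \<noteq> 0"
    \<comment> \<open>Otherwise three powers of \<open>x\<close> would be a basis of the whole
      algebra lying inside the complement.\<close>
    obtain a b c where e: "e = lc x (mul x x) (mul (mul x x) x) a b c"
      using basis3_span[OF nilpotent_cube_basis(1)[OF nil[OF x] c]] by blast
    have "lc x (mul x x) (mul (mul x x) x) a b c \<in> complement"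
      unfolding lc_def by (intro subspace_add[OF complement_subspace]
          subspace_scale[OF complement_subspace] x xx complement_mul[OF xx x])
    then have "e \<in> complement" by (simp flip: e)
    then show False using idem_not_in_complement by simp
  qed
  then have x3: "mul x (mul x x) = 0" and x4: "mul (mul x x) (mul x x) = 0"
    using right_alt_square[of x x] right_alt_square[of "mul x x" x] by simp_all
  have C: "basis3 e x (mul x x)"
    unfolding basis3_def
  proof (intro allI impI)
    fix a b c assume z: "lc e x (mul x x) a b c = 0"
    have "scl a e = mul e (lc e x (mul x x) a b c)"
      by (simp add: mul_lc_right ee complement_mul_0 x xx)
    with z have "scl a e = 0" by simp
    then have "a = 0" using idem_not_in_complement subspace_0[OF complement_subspace] by auto
    with z show "a = 0 \<and> b = 0 \<and> c = 0"
      using nilpotent_square_independent[OF nil[OF x] sq, of b c] by (simp add: lc_def)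
  qed
  show ?thesis
    by (rule listedI[where X = A11, OF C _ refl])
      (simp_all add: table_simps complement_mul_0 x xx ee cube x3 x4, simp_all add: lc_def)
next
  case False
  then have sq: "mul x x = 0" if "x \<in> complement" for x using that by blast
  have "mul (u + v) (u + v) = 0"
    using sq subspace_add[OF complement_subspace complement_basis] by simp
  then have vu: "mul v u = - mul u v"
    using sq complement_basis by (simp add: mul_add_left mul_add_right eq_neg_iff_add_eq_0 add.commute)
  have "mul u v \<in> complement" using complement_mul complement_basis by simp
  then obtain a b where uv: "mul u v = lc e u v 0 a b" by (auto simp: complement_def)
  note S = uv vu sq[OF complement_basis(1)] sq[OF complement_basis(2)] lc_simps
    lc_eq_0_iff[OF B]
  \<comment> \<open>Squares vanish, so (uv)v = u(vv) = 0; the coefficient of \<open>u\<close> in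
    (uv)v is the square of \<open>a\<close>. The next line is symmetric.\<close>
  have "a = 0" using right_alt_square[of u v] by (auto simp: S)
  moreover have "b = 0" using right_alt_square[of v u] by (auto simp: S)
  ultimately have 0: "mul u v = 0" "mul v u = 0" using uv vu by (simp_all add: lc_zero)
  show ?thesis
    by (rule listedI[where X = A03, OF B _ refl])
      (simp_all add: table_simps 0 ee eu ev sq complement_basis, simp_all add: lc_def)
qed

lemma listed_peirce_00: listed
proof (cases "\<forall>x\<in>complement. nilpotent x")
  case True
  then show ?thesis using listed_complement_nil by blast
next
  case False
  then obtain x where x: "x \<in> complement" "\<not> nilpotent x" by blast
  then obtain q where q: "ev x q \<noteq> 0" "mul (ev x q) (ev x q) = ev x q"
    using idempotent_of_not_nilpotent by blast
  show ?thesis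
    by (rule listed_complement_idempotent[OF ev_closed[OF complement_subspace complement_mul x(1)] q])
qed

end

text \<open>The existence of \<open>w\<close> shows that 0 is an eigenvalue, so in an adapted basis
  one of the vectors besides \<open>f\<close> lies in \<open>J_0\<close>; the Peirce space of the
  other selects the case.\<close>

lemma listed_of_peirce_0:
  assumes f: "mul f f = f" "f \<noteq> 0" and w: "w \<noteq> 0" "mul f w = 0" "mul w f = 0"
  shows listed
proof -
  obtain u v i j where B: "basis3 f u v" and u: "peirce f i u" and v: "peirce f j v"
    and i: "i \<in> {0, 1, 2}" and j: "j \<in> {0, 1, 2}"
    using peirce_basis[OF f] by metis
  have listed if B: "basis3 f x y" and x: "peirce f k x" "k \<in> {0, 1, 2}" and y: "peirce f 0 y" for x y k
  proof -
    note y0 = peirce_0_D[OF f(1) y]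
    consider "peirce f 0 x" | "peirce f 1 x" | "peirce f 2 x" using x by auto
    then show ?thesis
    proof cases
      case 1
      show ?thesis by (rule listed_peirce_00[OF B f(1) peirce_0_D[OF f(1) 1] y0])
    next
      case 2
      show ?thesis by (rule listed_peirce_10[OF B f(1) 2 y0])
    next
      case 3
      show ?thesis by (rule listed_peirce_20[OF B f(1) peirce_2_D[OF f(1) 3] y0])
    qed
  qed
  note * = this
  have "i = 0 \<or> j = 0"
  proof (rule ccontr)
    assume ij: "\<not> (i = 0 \<or> j = 0)"
    obtain a b c where abc: "w = lc f u v a b c" using basis3_span[OF B] by blast
    have f2: "mul f f + mul f f = scl 2 f"
      by (simp add: f scale_left_distrib[of 1 1, simplified])
    have "mul f w + mul w f = scl a (mul f f + mul f f) + scl b (mul f u + mul u f) + scl c (mul f v + mul v f)"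
      by (simp add: abc mul_lc_left mul_lc_right algebra_simps)
    also have "\<dots> = lc f u v (2 * a) (b * i) (c * j)"
      unfolding f2 u[unfolded peirce_def] v[unfolded peirce_def] by (simp add: lc_def mult.commute)
    finally have "lc f u v (2 * a) (b * i) (c * j) = 0" using w by simp
    then have "a = 0" "b = 0" "c = 0" using ij by (auto simp: lc_eq_0_iff[OF B])
    then show False using w abc by (simp add: lc_zero)
  qed
  then show ?thesis
    using *[OF B u i] *[OF basis3_swap[OF B] v j] u v by blast
qed

section \<open>Idempotents whose \<open>J_0\<close> is zero\<close>

text \<open>Again right multiplication by \<open>e\<close> is idempotent, so the coefficient
  \<open>c\<close> of \<open>v\<close> in \<open>v e\<close> is 0 or 1. The value 1 gives
  \<open>R05\<close>. For the value 0 only the component \<open>b u\<close> of \<open>v e\<close> in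
  \<open>J_2\<close> can survive.\<close>

lemma listed_peirce_21_nil:
  assumes B: "basis3 e u v" and ee: "mul e e = e" and eu: "mul e u = u" "mul u e = u"
    and uu: "mul u u = 0" and v: "peirce e 1 v"
  shows listed
proof -
  have ee': "mul e e = lc e u v 1 0 0" and eu': "mul e u = lc e u v 0 1 0" "mul u e = lc e u v 0 1 0"
    using ee eu by (simp_all add: lc_unit)
  obtain a b c where ve: "mul v e = lc e u v a b c" using basis3_span[OF B] by blast
  obtain q1 q2 q3 where q: "mul u v = lc e u v q1 q2 q3" using basis3_span[OF B] by blast
  obtain r1 r2 r3 where r: "mul v u = lc e u v r1 r2 r3" using basis3_span[OF B] by blast
  obtain s1 s2 s3 where s: "mul v v = lc e u v s1 s2 s3" using basis3_span[OF B] by blast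
  have ev: "mul e v = lc e u v (- a) (- b) (1 - c)"
  proof -
    have "mul e v = lc e u v 0 0 1 - lc e u v a b c"
      using v by (simp add: peirce_def lc_unit eq_diff_eq flip: ve)
    then show ?thesis by (simp add: lc_diff)
  qed
  note S = ee' eu' uu ve q r s ev lc_simps lc_eq_iff[OF B] lc_eq_0_iff[OF B] complex_add_self_eq_0
  have "a + c * a = a \<and> b + c * b = b \<and> c * c = c"
    using right_alt_square[of v e] by (simp add: S ee)
  then consider "c = 1" "a = 0" "b = 0" | "c = 0" by auto
  then show ?thesis
  proof cases
    case 1
    have q0: "q1 = 0" "q2 = 0" "q3 = 0" using right_alt_linearized[of u v e] 1 by (auto simp: S)
    have s0: "s1 = 0" "s2 = 0" "s3 = 0" using right_alt_linearized[of v v e] 1 by (auto simp: S)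
    have r1: "r1 = 0" "r2 = 0" using right_alt_linearized[of e u v] 1 q0 by (auto simp: S)
    have r3: "r3 = 0" using right_alt_square[of v u] r1 by (simp add: S)
    show ?thesis
      using 1 q0 s0 r1 r3
      by (intro listedI[where X = R05 and x = "lc e u v 1 0 0" and y = "lc e u v 0 0 1"
            and z = "lc e u v 0 1 0", OF _ _ refl]) (simp_all add: S table_simps basis3_def)
  next
    case 2
    have q12: "q1 = - q3 * a" "q2 = - q3 * b"
      using right_alt_linearized[of u v e] 2 by (simp_all add: S eq_neg_iff_add_eq_0 add.commute)
    have r13: "r1 = 0" "r2 = a" "r3 = 0"
      using right_alt_linearized[of v u e] 2 by (auto simp: S)
    have qa: "q3 * a = 0" "q3 * b = a"
      using right_alt_linearized[of e u v] 2 q12 r13 by (simp_all add: S) algebra+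
    have a: "a = 0" using qa by auto
    have q3: "q3 = 0"
      using right_alt_linearized[of u u v] 2 q12 r13 a by (auto simp: S)
    have s3: "s3 = 0"
      using right_alt_linearized[of v v e] 2 a q12 q3 by (auto simp: S)
    have s1: "s1 = 0"
      using right_alt_square[of v v] 2 a s3 r13 q12 q3 by (auto simp: S)
    have U: "mul v e = lc e u v 0 b 0" "mul e v = lc e u v 0 (- b) 1" "mul u v = 0" "mul v u = 0"
      "mul v v = lc e u v 0 s2 0"
      using 2 a q12 q3 r13 s1 s3 by (simp_all add: S)
    note S' = ee' eu' uu U lc_simps lc_eq_iff[OF B] lc_eq_0_iff[OF B] table_simps basis3_def
    consider "s2 \<noteq> 0" | "s2 = 0" "b = 0" | "s2 = 0" "b \<noteq> 0" by blast
    then show ?thesis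
    proof cases
      case 1
      \<comment> \<open>Since \<open>v v = s2 u\<close>, the element
        \<open>e + t v - t^2 v v\<close> is idempotent for every \<open>t\<close>. This value makes
        the product of \<open>v - 2 b u\<close> with it, in this order, vanish, which removes
        \<open>b\<close>.\<close>
      define t where "t = b / s2"
      have b: "b = t * s2" using 1 by (simp add: t_def)
      from 1 show ?thesis
        by (intro listedI[where X = R10 and x = "lc e u v 1 (- (t * t * s2)) t"
            and y = "lc e u v 0 (- 2 * t * s2) 1" and z = "lc e u v 0 s2 0", OF _ _ refl])
          (simp_all add: S' b algebra_simps)
    next
      case 2
      then show ?thesis
        by (intro listedI[where X = R03 and x = "lc e u v 1 0 0" and y = "lc e u v 0 0 1"
            and z = "lc e u v 0 1 0", OF _ _ refl]) (simp_all add: S')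
    next
      case 3
      then show ?thesis
        by (intro listedI[where X = R04 and x = "lc e u v 1 0 0" and y = "lc e u v 0 0 1"
            and z = "lc e u v 0 (- b) 0", OF _ _ refl]) (simp_all add: S')
    qed
  qed
qed

text \<open>The numbers \<open>i\<close> and \<open>j\<close> are the eigenvalues of right
  multiplication by \<open>e\<close> modulo the line of \<open>e\<close>. The condition
  \<open>b = 0\<close> of the last case is arranged in \<open>listed_peirce_11\<close> by a change
  of basis.\<close>

lemma listed_peirce_11_projection:
  assumes B: "basis3 e u v" and ee: "mul e e = e"
    and eu: "mul e u = lc e u v (- a) (1 - i) 0" "mul u e = lc e u v a i 0"
    and ev: "mul e v = lc e u v (- b) 0 (1 - j)" "mul v e = lc e u v b 0 j"
    and ij: "(i = 1 \<and> j = 1) \<or> (i = 1 \<and> j = 0) \<or> (i = 0 \<and> j = 0 \<and> b = 0)"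
  shows listed
proof -
  have ee': "mul e e = lc e u v 1 0 0" using ee by (simp add: lc_unit)
  obtain p1 p2 p3 where p: "mul u u = lc e u v p1 p2 p3" using basis3_span[OF B] by blast
  obtain q1 q2 q3 where q: "mul u v = lc e u v q1 q2 q3" using basis3_span[OF B] by blast
  obtain r1 r2 r3 where r: "mul v u = lc e u v r1 r2 r3" using basis3_span[OF B] by blast
  obtain s1 s2 s3 where s: "mul v v = lc e u v s1 s2 s3" using basis3_span[OF B] by blast
  note S = ee' eu ev p q r s lc_simps lc_eq_iff[OF B] lc_eq_0_iff[OF B] complex_add_self_eq_0
  have ab: "i = 1 \<Longrightarrow> a = 0" "j = 1 \<Longrightarrow> b = 0"
    using right_alt_square[of u e] right_alt_square[of v e] by (auto simp: S ee)
  show ?thesis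
    using ij
  proof (elim disjE conjE)
    assume 1: "i = 1" "j = 1"
    have 0: "p1 = 0" "p2 = 0" "p3 = 0" "q1 = 0" "q2 = 0" "q3 = 0"
      "r1 = 0" "r2 = 0" "r3 = 0" "s1 = 0" "s2 = 0" "s3 = 0"
      using right_alt_linearized[of u u e] right_alt_linearized[of u v e]
        right_alt_linearized[of v u e] right_alt_linearized[of v v e] 1 ab by (auto simp: S)
    show ?thesis
      using 0 1 ab
      by (intro listedI[where X = R07 and x = "lc e u v 1 0 0" and y = "lc e u v 0 1 0"
            and z = "lc e u v 0 0 1", OF _ _ refl]) (simp_all add: S table_simps basis3_def)
  next
    assume 1: "i = 1" "j = 0"
    then have a: "a = 0" using ab by simp
    have pq: "p2 = 0" "q2 = 0" "p1 = - b * p3" "q1 = - b * q3"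
      using right_alt_linearized[of u u e] right_alt_linearized[of u v e] 1 a
      by (auto simp: S eq_neg_iff_add_eq_0 mult.commute)
    have r3: "r3 = 0" using right_alt_linearized[of v u e] 1 a by (auto simp: S)
    have s3: "s3 = b" using right_alt_linearized[of v v e] 1 by (auto simp: S)
    have qr: "q3 = 0" "r2 = 0"
      using right_alt_linearized[of e u v] 1 a pq r3 by (auto simp: S)
    have p3: "p3 = 0" using right_alt_linearized[of e u u] 1 a pq by (auto simp: S)
    have b: "b = 0" "s2 = 0" using right_alt_linearized[of e v v] 1 a s3 pq p3 by (auto simp: S)
    have s1: "s1 = 0" using right_alt_square[of v v] 1 a b s3 by (auto simp: S)
    have r1: "r1 = 0" using right_alt_linearized[of v u v] 1 a b s3 s1 pq qr r3 by (auto simp: S)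
    show ?thesis
      using 1 a b s1 s3 r1 r3 qr p3 pq
      by (intro listedI[where X = R08 and x = "lc e u v 1 0 0" and y = "lc e u v 0 1 0"
            and z = "lc e u v 0 0 1", OF _ _ refl]) (simp_all add: S table_simps basis3_def)
  next
    assume 1: "i = 0" "j = 0" "b = 0"
    have vv: "s2 = 0" "s3 = 0" using right_alt_linearized[of v v e] 1 by (auto simp: S)
    have vu: "r2 = 0" "r3 = 0" using right_alt_linearized[of v u e] 1 by (auto simp: S)
    have uv: "q2 = 0" "q3 = a" using right_alt_linearized[of u v e] 1 by (auto simp: S)
    have up: "p3 = 0" "p2 = a" using right_alt_linearized[of u u e] 1 by (auto simp: S)
    have a: "a = 0" using right_alt_linearized[of e u u] 1 up by (auto simp: S)
    have sp: "s1 = 0" "p1 = 0"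
      using right_alt_square[of v v] right_alt_square[of u u] 1 a vv up by (auto simp: S)
    have rq: "r1 = 0" "q1 = 0"
      using right_alt_linearized[of v v u] right_alt_linearized[of u u v] 1 a vv vu uv up sp
      by (auto simp: S)
    show ?thesis
      using 1 a vv vu uv up sp rq
      by (intro listedI[where X = R06 and x = "lc e u v 1 0 0" and y = "lc e u v 0 1 0"
            and z = "lc e u v 0 0 1", OF _ _ refl]) (simp_all add: S table_simps basis3_def)
  qed
qed

text \<open>The square of \<open>u\<close> stays in \<open>J_2\<close>, so
  \<open>unital_plane\<close> applies. An idempotent \<open>n\<close> is orthogonal to
  \<open>e - n\<close> and thus has a nonzero \<open>J_0\<close>; otherwise \<open>n\<close> has
  square zero.\<close>

lemma listed_peirce_21:
  assumes B: "basis3 e u v" and ee: "mul e e = e" and eu: "mul e u = u" "mul u e = u"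
    and v: "peirce e 1 v"
  shows listed
proof -
  have ee': "mul e e = lc e u v 1 0 0" and eu': "mul e u = lc e u v 0 1 0" "mul u e = lc e u v 0 1 0"
    using ee eu by (simp_all add: lc_unit)
  obtain a b c where ve: "mul v e = lc e u v a b c" using basis3_span[OF B] by blast
  obtain p1 p2 p3 where p: "mul u u = lc e u v p1 p2 p3" using basis3_span[OF B] by blast
  have ev: "mul e v = lc e u v (- a) (- b) (1 - c)"
  proof -
    have "mul e v = lc e u v 0 0 1 - lc e u v a b c"
      using v by (simp add: peirce_def lc_unit eq_diff_eq flip: ve)
    then show ?thesis by (simp add: lc_diff)
  qed
  note S = ee' eu' ve p ev lc_simps lc_eq_iff[OF B] lc_eq_0_iff[OF B] complex_add_self_eq_0
  have "p3 = 0" using right_alt_linearized[of u u e] right_alt_linearized[of e u u] by (auto simp: S)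
  then obtain n where n: "basis3 e n v" "mul e n = n" "mul n e = n" "mul n n = 0 \<or> mul n n = n"
    using unital_plane[OF B ee eu] p by metis
  show ?thesis
  proof (cases "mul n n = 0")
    case False
    then have nn: "mul n n = n" using n(4) by blast
    have "n \<noteq> 0" using False by auto
    moreover have "e - n \<noteq> 0"
      using lc_eq_0_iff[OF n(1), of 1 "-1" 0] by (simp add: lc_def)
    moreover have "mul n (e - n) = 0" "mul (e - n) n = 0"
      by (simp_all add: mul_diff_left mul_diff_right n(2,3) nn)
    ultimately show ?thesis by (rule listed_of_peirce_0[OF nn])
  next
    case True
    show ?thesis by (rule listed_peirce_21_nil[OF n(1) ee n(2,3) True v])
  qed
qed

text \<open>On \<open>J_1\<close>, right multiplication by \<open>e\<close> is a projection only
  modulo the line of \<open>e\<close>. The sets \<open>T 0\<close> and \<open>T 1\<close> are its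
  eigenspaces in this sense, and the basis is chosen inside them.\<close>

lemma listed_peirce_11:
  assumes B: "basis3 e u v" and ee: "mul e e = e" and u: "peirce e 1 u" and v: "peirce e 1 v"
  shows listed
proof -
  define T where "T i = {w. peirce e 1 w \<and> (\<exists>a. mul w e = scl a e + scl i w)}" for i
  have split: "w \<in> span ({e} \<union> T 0 \<union> T 1)" if w: "peirce e 1 w" for w
  proof -
    obtain a b c where abc: "mul w e = lc e u v a b c" using basis3_span[OF B] by blast
    define w' where "w' = scl b u + scl c v"
    have we: "mul w e = scl a e + w'" by (simp add: abc w'_def lc_def add.assoc)
    have p: "peirce e 1 w'"
      using u v by (simp add: peirce_def w'_def mul_add_left mul_add_right mul_scale_left mul_scale_right
          flip: scale_right_distrib) (simp add: add_ac flip: scale_right_distrib)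
    have "mul (mul w e) e = mul w e" by (rule idem_right_twice[OF ee])
    \<comment> \<open>Comparing \<open>mul (mul w e) e\<close> with \<open>mul w e\<close> cancels
      the multiple of \<open>e\<close>, so the part of \<open>mul w e\<close> inside
      \<open>J_1\<close> is fixed exactly.\<close>
    then have w'e: "mul w' e = w'"
      by (simp add: we mul_add_left mul_scale_left ee)
    have "w' \<in> T 1" unfolding T_def using p w'e by (auto intro: exI[of _ 0])
    moreover have "peirce e 1 (w - w')"
      using p w unfolding peirce_def by (simp add: mul_diff_left mul_diff_right) (metis add_diff_add)
    then have "w - w' \<in> T 0"
      unfolding T_def by (auto simp: mul_diff_left we w'e)
    ultimately have "(w - w') + w' \<in> span ({e} \<union> T 0 \<union> T 1)"
      by (intro span_add span_base) auto
    then show ?thesis by simp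
  qed
  have "x \<in> span ({e} \<union> T 0 \<union> T 1)" for x
  proof -
    obtain a b c where "x = lc e u v a b c" using basis3_span[OF B] by blast
    then show ?thesis
      unfolding lc_def using split[OF u] split[OF v]
      by (auto intro!: span_add span_scale span_base[of e])
  qed
  then have "span ({e} \<union> T 0 \<union> T 1) = UNIV" by blast
  moreover have e0: "e \<noteq> 0" using lc_eq_0_iff[OF B, of 1 0 0] by (simp add: lc_unit)
  ultimately obtain x y where xy: "x \<in> {e} \<union> T 0 \<union> T 1" "y \<in> {e} \<union> T 0 \<union> T 1" and C: "basis3 e x y"
    using extend_basis3[of "{e} \<union> T 0 \<union> T 1" e] by blast
  have "x \<noteq> e" "y \<noteq> e"
    using lc_eq_0_iff[OF C, of 1 "-1" 0] lc_eq_0_iff[OF C, of 1 0 "-1"] by (auto simp: lc_def)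
  have left: "mul e w = w - mul w e" if "peirce e 1 w" for w
    using that by (simp add: peirce_def algebra_simps)
  have lists: listed if D: "basis3 e x y" and x: "x \<in> T i" and y: "y \<in> T j"
    and ij: "(i = 1 \<and> j = 1) \<or> (i = 1 \<and> j = 0) \<or> (i = 0 \<and> j = 0 \<and> mul y e = 0)" for x y i j
  proof -
    obtain a where xe: "mul x e = lc e x y a i 0" and x1: "peirce e 1 x"
      using x by (auto simp: T_def lc_def)
    obtain b where ye: "mul y e = lc e x y b 0 j" and y1: "peirce e 1 y"
      using y by (auto simp: T_def lc_def)
    have ex: "mul e x = lc e x y (- a) (1 - i) 0"
      using left[OF x1] xe lc_diff[of e x y 0 1 0 a i 0] by (simp add: lc_unit)
    have ey: "mul e y = lc e x y (- b) 0 (1 - j)"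
      using left[OF y1] ye lc_diff[of e x y 0 0 1 b 0 j] by (simp add: lc_unit)
    show ?thesis
      using ij ye by (intro listed_peirce_11_projection[OF D ee ex xe ey ye]) (auto simp: lc_eq_0_iff[OF D])
  qed
  consider "x \<in> T 1" "y \<in> T 1" | "x \<in> T 1" "y \<in> T 0" | "x \<in> T 0" "y \<in> T 1" | "x \<in> T 0" "y \<in> T 0"
    using xy \<open>x \<noteq> e\<close> \<open>y \<noteq> e\<close> by blast
  then show ?thesis
  proof cases
    case 1
    then show ?thesis by (intro lists[OF C 1]) auto
  next
    case 2
    then show ?thesis by (intro lists[OF C 2]) auto
  next
    case 3
    then show ?thesis by (intro lists[OF basis3_swap[OF C] 3(2,1)]) auto
  next
    case 4
    then obtain a b where ab: "mul x e = scl a e" "mul y e = scl b e" by (auto simp: T_def)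
    show ?thesis
    proof (cases "b = 0")
      case True
      then show ?thesis using ab by (intro lists[OF C 4]) auto
    next
      case False
      \<comment> \<open>Right multiplication by \<open>e\<close> sends \<open>x\<close> and
        \<open>y\<close> to multiples of \<open>e\<close>; this combination is sent to 0.\<close>
      define z where "z = x - scl (a / b) y"
      have "basis3 e y z"
        unfolding basis3_def
      proof (intro allI impI)
        fix k l m assume "lc e y z k l m = 0"
        then have "lc e x y k m (l - m * (a / b)) = 0"
          by (simp add: lc_def z_def scale_right_diff_distrib scale_left_diff_distrib algebra_simps)
        then show "k = 0 \<and> l = 0 \<and> m = 0" by (auto simp: lc_eq_0_iff[OF C])
      qed
      moreover have ze: "mul z e = 0"
        using False by (simp add: z_def mul_diff_left mul_scale_left ab)
      moreover have "mul e z = z"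
        using 4 left[of x] left[of y] False
        by (simp add: T_def z_def mul_diff_right mul_scale_right ab scale_right_diff_distrib)
      then have "z \<in> T 0" using ze by (auto simp: T_def peirce_def intro!: exI[of _ 0])
      ultimately show ?thesis using 4 by (intro lists[of y z 0 0]) auto
    qed
  qed
qed

section \<open>Algebras with a unit\<close>

lemma eigenvector_exists:
  assumes B: "basis3 e u v"
    and add: "\<And>x y. f (x + y) = f x + f y" and scale: "\<And>c x. f (scl c x) = scl c (f x)"
  obtains k z where "z \<noteq> 0" "f z = scl k z"
proof -
  obtain a1 a2 a3 where fe: "f e = lc e u v a1 a2 a3" using basis3_span[OF B] by blast
  obtain b1 b2 b3 where fu: "f u = lc e u v b1 b2 b3" using basis3_span[OF B] by blast
  obtain c1 c2 c3 where fv: "f v = lc e u v c1 c2 c3" using basis3_span[OF B] by blast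
  define M :: "complex \<Rightarrow> complex^3^3" where
    "M k = vector [vector [a1 - k, b1, c1], vector [a2, b2 - k, c2], vector [a3, b3, c3 - k]]" for k
  \<comment> \<open>The expansion of \<open>det (M k)\<close> as a polynomial in \<open>k\<close>;
    the factor \<open>[:a1, -1:]\<close> stands for \<open>a1 - k\<close>.\<close>
  define p where "p = [:a1, -1:] * [:b2, -1:] * [:c3, -1:] + [:b1 * c2 * a3 + c1 * a2 * b3:]
    - smult (c2 * b3) [:a1, -1:] - smult (b1 * a2) [:c3, -1:] - smult (c1 * a3) [:b2, -1:]"
  have "degree p = 3" by (simp add: p_def)
  then obtain k where k: "poly p k = 0"
    using alg_closed_imp_poly_has_root[of p] by auto
  have "det (M k) = poly p k"
    by (simp add: M_def p_def det_3 algebra_simps)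
  then have "\<not> invertible (M k)" using k by (simp add: invertible_det_nz)
  then obtain w where w: "w \<noteq> 0" "M k *v w = 0"
    by (auto simp: invertible_left_inverse matrix_left_invertible_ker)
  define z where "z = lc e u v (w $ 1) (w $ 2) (w $ 3)"
  have "z \<noteq> 0" using w(1) by (simp add: z_def lc_eq_0_iff[OF B] vec_eq_iff forall_3)
  moreover have "f z = scl k z"
    using w(2) unfolding z_def
    by (simp add: lc_def[of e u v "w $ 1"] add scale fe fu fv,
        simp add: lc_scale lc_add M_def vec_eq_iff forall_3 matrix_vector_mult_def sum_3 algebra_simps,
        simp add: lc_def add_ac)
  ultimately show ?thesis by (rule that)
qed

text \<open>A nontrivial idempotent \<open>f\<close> has \<open>e - f\<close> in its 0-space.
  Without one the algebra behaves like a local ring: every element is a multiple of \<open>e\<close>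
  plus a nilpotent.\<close>

lemma listed_unital:
  assumes ee: "e \<noteq> 0" and unit: "\<And>x. mul e x = x" "\<And>x. mul x e = x"
  shows listed
proof (cases "\<exists>f. mul f f = f \<and> f \<noteq> 0 \<and> f \<noteq> e")
  case True
  then obtain f where "mul f f = f" "f \<noteq> 0" "e - f \<noteq> 0" by auto
  then show ?thesis
    using unit by (intro listed_of_peirce_0[of f "e - f"]) (auto simp: mul_diff_left mul_diff_right)
next
  case False
  then have triv: "f = 0 \<or> f = e" if "mul f f = f" for f using that by blast
  obtain u0 v0 where B0: "basis3 e u0 v0" using extend_basis3[of UNIV e] ee by auto
  have nil: "\<exists>k. nilpotent (x - scl k e)" for x
  proof -
    obtain k z where z: "z \<noteq> 0" "mul z x = scl k z"
      by (rule eigenvector_exists[OF B0, of "\<lambda>z. mul z x"]) (auto simp: mul_add_left mul_scale_left)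
    let ?y = "x - scl k e"
    have zy: "mul z ?y = 0" by (simp add: mul_diff_right mul_scale_right unit z)
    have "nilpotent ?y"
    proof (rule ccontr)
      assume "\<not> nilpotent ?y"
      then obtain q where q: "ev ?y q \<noteq> 0" "mul (ev ?y q) (ev ?y q) = ev ?y q"
        by (rule idempotent_of_not_nilpotent)
      \<comment> \<open>If \<open>x - k e\<close> were not nilpotent, \<open>e\<close> would be a
        polynomial in it without constant term, hence annihilated from the left by the eigenvector
        \<open>z\<close>.\<close>
      then have "ev ?y q = e" using triv by blast
      then have "mul z e = 0" using ev_annihilated[OF zy, of q] by simp
      then show False using unit z by simp
    qed
    then show ?thesis by blast
  qed
  show ?thesis
  proof (cases "\<exists>n. nilpotent n \<and> mul n n \<noteq> 0")
    case True
    then obtain n where n: "nilpotent n" and sq: "mul n n \<noteq> 0" by blast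
    have cube: "mul (mul n n) n = 0"
    proof (rule ccontr)
      assume c: "mul (mul n n) n \<noteq> 0"
      note nb = nilpotent_cube_basis[OF n c]
      obtain a b c where e: "e = lc n (mul n n) (mul (mul n n) n) a b c"
        using basis3_span[OF nb(1)] by blast
      \<comment> \<open>A combination of positive powers of \<open>n\<close> is killed by three
        right multiplications by \<open>n\<close>, but from \<open>e\<close> these produce the
        nonzero cube.\<close>
      have "mul (mul (mul e n) n) n = 0"
        unfolding e lc_def by (simp add: mul_add_left mul_scale_left nb(2))
      then show False using c by (simp add: unit)
    qed
    then have x3: "mul n (mul n n) = 0" and x4: "mul (mul n n) (mul n n) = 0"
      using right_alt_square[of n n] right_alt_square[of "mul n n" n] by simp_all
    have C: "basis3 e n (mul n n)"
      unfolding basis3_def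
    proof (intro allI impI)
      fix a b c assume z: "lc e n (mul n n) a b c = 0"
      have "mul (lc e n (mul n n) a b c) (mul n n) = scl a (mul n n)"
        by (simp add: mul_lc_left unit x3 x4)
      then have "a = 0" using z sq by simp
      with z show "a = 0 \<and> b = 0 \<and> c = 0"
        using nilpotent_square_independent[OF n sq, of b c] by (simp add: lc_def)
    qed
    show ?thesis
      by (rule listedI[where X = A10, OF C _ refl])
        (simp_all add: table_simps unit cube x3 x4, simp_all add: lc_def)
  next
    case False
    then have sq0: "mul n n = 0" if "nilpotent n" for n using that by blast
    obtain k l where kl: "nilpotent (u0 - scl k e)" "nilpotent (v0 - scl l e)" using nil by blast
    define u where "u = u0 - scl k e"
    define v where "v = v0 - scl l e"
    have B: "basis3 e u v"
      unfolding basis3_def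
    proof (intro allI impI)
      fix a b c assume "lc e u v a b c = 0"
      then have "lc e u0 v0 (a - b * k - c * l) b c = 0"
        by (simp add: lc_def u_def v_def scale_right_diff_distrib scale_left_diff_distrib algebra_simps)
      then show "a = 0 \<and> b = 0 \<and> c = 0" by (auto simp: lc_eq_0_iff[OF B0])
    qed
    have uu: "mul u u = 0" "mul v v = 0" using sq0 kl by (auto simp: u_def v_def)
    obtain q1 q2 q3 where q: "mul u v = lc e u v q1 q2 q3" using basis3_span[OF B] by blast
    obtain r1 r2 r3 where r: "mul v u = lc e u v r1 r2 r3" using basis3_span[OF B] by blast
    have P: "mul e e = lc e u v 1 0 0" "mul e u = lc e u v 0 1 0" "mul u e = lc e u v 0 1 0"
      "mul e v = lc e u v 0 0 1" "mul v e = lc e u v 0 0 1"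
      by (simp_all add: unit lc_unit)
    note S = P uu q r lc_simps lc_eq_iff[OF B] lc_eq_0_iff[OF B]
    \<comment> \<open>It is not yet known that \<open>u + v\<close> and \<open>u - v\<close> are
      nilpotent. Subtracting their scalar parts \<open>a\<close> and \<open>b\<close> and squaring
      evaluates \<open>uv + vu\<close> twice; comparison gives \<open>a = b = - a\<close>.\<close>
    obtain a where "nilpotent ((u + v) - scl a e)" using nil by blast
    then have "mul (lc e u v (- a) 1 1) (lc e u v (- a) 1 1) = 0"
      using sq0 by (simp add: lc_def algebra_simps)
    then have 1: "q2 + r2 = 2 * a" "q3 + r3 = 2 * a" by (simp_all add: S) algebra+
    obtain b where "nilpotent ((u - v) - scl b e)" using nil by blast
    then have "mul (lc e u v (- b) 1 (-1)) (lc e u v (- b) 1 (-1)) = 0"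
      using sq0 by (simp add: lc_def algebra_simps)
    then have b: "- (2 * b) - r2 = q2" "2 * b + (- r3 - q3) = 0" by (simp_all add: S)
    have 2: "q2 + r2 = - (2 * b)" by (simp flip: b(1))
    have "2 * b - (q3 + r3) = 0" using b(2) by (simp add: algebra_simps)
    then have 3: "q3 + r3 = 2 * b" by simp
    have q0: "q1 = 0" "q2 = 0" using right_alt_square[of u v] by (auto simp: S)
    have r0: "r1 = 0" "r3 = 0" using right_alt_square[of v u] by (auto simp: S)
    have "2 * a = 2 * b" "2 * a = - (2 * b)" using 1 2 3 by simp_all
    then have "2 * a + 2 * a = 0" by simp
    then have "a = 0" by simp
    then have qr: "q3 = 0" "r2 = 0" using 1 q0 r0 by auto
    show ?thesis
      using q0 r0 qr
      by (intro listedI[where X = A09 and x = "lc e u v 1 0 0" and y = "lc e u v 0 1 0"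
            and z = "lc e u v 0 0 1", OF _ _ refl]) (simp_all add: S table_simps basis3_def)
  qed
qed

lemma listed_of_idempotent:
  assumes e: "mul e e = e" "e \<noteq> 0"
  shows listed
proof -
  obtain u v i j where B: "basis3 e u v" and u: "peirce e i u" and v: "peirce e j v"
    and i: "i \<in> {0, 1, 2}" and j: "j \<in> {0, 1, 2}"
    using peirce_basis[OF e] by metis
  have nz: "u \<noteq> 0" "v \<noteq> 0"
    using lc_eq_0_iff[OF B, of 0 1 0] lc_eq_0_iff[OF B, of 0 0 1] by (auto simp: lc_unit)
  consider "i = 0 \<or> j = 0" | "i = 1" "j = 1" | "i = 2" "j = 1" | "i = 1" "j = 2" | "i = 2" "j = 2"
    using i j by auto
  then show ?thesis
  proof cases
    case 1
    then show ?thesis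
      using listed_of_peirce_0[OF e] peirce_0_D[OF e(1)] nz u v by auto
  next
    case 2
    then show ?thesis using listed_peirce_11[OF B e(1)] u v by simp
  next
    case 3
    then show ?thesis using listed_peirce_21[OF B e(1)] peirce_2_D[OF e(1)] u v by simp
  next
    case 4
    then show ?thesis using listed_peirce_21[OF basis3_swap[OF B] e(1)] peirce_2_D[OF e(1)] u v by simp
  next
    case 5
    then have uv: "mul e u = u" "mul u e = u" "mul e v = v" "mul v e = v"
      using peirce_2_D[OF e(1)] u v by auto
    have "mul e x = x \<and> mul x e = x" for x
    proof -
      obtain a b c where "x = lc e u v a b c" using basis3_span[OF B] by blast
      then show ?thesis by (simp add: mul_lc_left mul_lc_right e uv) (simp add: lc_def)
    qed
    then show ?thesis by (intro listed_unital[OF e(2)]) auto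
  qed
qed

section \<open>Algebras without idempotents\<close>

text \<open>The product is a bilinear form on the span of \<open>x\<close> and \<open>w\<close> with
  values in the line of \<open>z\<close>. Its symmetric part has rank 1 or 2, its skew part is
  arbitrary, and these data determine the algebra.\<close>

lemma listed_annihilating_form:
  assumes B: "basis3 x z w" and xx: "mul x x = z" and xw: "mul x w = scl b z" and wx: "mul w x = 0"
    and ww: "mul w w = scl s z"
    and z: "mul z z = 0" "mul z x = 0" "mul x z = 0" "mul z w = 0" "mul w z = 0"
  shows listed
proof -
  have P: "mul x x = lc x z w 0 1 0" "mul x w = lc x z w 0 b 0" "mul w w = lc x z w 0 s 0"
    using xx xw ww by (simp_all add: lc_def)
  note S = P wx z lc_simps lc_eq_iff[OF B] lc_eq_0_iff[OF B] table_simps basis3_def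
  \<comment> \<open>The symmetric part pairs \<open>x\<close> and \<open>w\<close> to
    \<open>c\<close>, so \<open>w - c x\<close> is orthogonal to \<open>x\<close>, and its square is
    \<open>d z\<close>. Thus \<open>d = 0\<close> means rank 1.\<close>
  define c where "c = b / 2"
  define d where "d = s - c * c"
  have b: "b = 2 * c" and s: "s = d + c * c" by (simp_all add: c_def d_def)
  consider "c = 0" "d = 0" | "c \<noteq> 0" "d = 0" | "d \<noteq> 0" by blast
  then show ?thesis
  proof cases
    case 1
    then show ?thesis
      by (intro listedI[where X = A04 and x = "lc x z w 1 0 0" and y = "lc x z w 0 1 0"
            and z = "lc x z w 0 0 1", OF _ _ refl]) (simp_all add: S b s)
  next
    case 2
    then show ?thesis
      by (intro listedI[where X = R01 and x = "lc x z w 1 0 0" and y = "lc x z w 0 1 0"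
            and z = "lc x z w (-1) 0 (1 / c)", OF _ _ refl]) (simp_all add: S b s)
  next
    case 3
    \<comment> \<open>With \<open>w' = k (w - c x)\<close> one has \<open>w' w' = - z\<close>, so \<open>x + w'\<close> and \<open>x - w'\<close> have square zero.\<close>
    define k where "k = \<i> / csqrt d"
    have k: "k * k * d = - 1" "k \<noteq> 0"
    proof -
      have "csqrt d * csqrt d = d" by (metis power2_csqrt power2_eq_square)
      then have "k * k * d = \<i> * \<i> * (d / d)" by (simp add: k_def)
      then show "k * k * d = - 1" using 3 by simp
      then show "k \<noteq> 0" by auto
    qed
    define t where "t = k * c"
    have kc: "k * (k * (d + c * c)) = t * t - 1" using k(1) by (simp add: t_def algebra_simps)
    have e: "mul (lc x z w (1 - t) 0 k) (lc x z w (1 - t) 0 k) = 0"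
      "mul (lc x z w (1 - t) 0 k) (lc x z w (1 + t) 0 (- k)) = lc x z w 0 (2 - 2 * t) 0"
      "mul (lc x z w (1 + t) 0 (- k)) (lc x z w (1 - t) 0 k) = lc x z w 0 (2 + 2 * t) 0"
      "mul (lc x z w (1 + t) 0 (- k)) (lc x z w (1 + t) 0 (- k)) = 0"
      using k(1) by (simp_all add: S b s t_def) algebra+
    have zz: "mul (lc x z w 0 2 0) y = 0" "mul y (lc x z w 0 2 0) = 0" if "y \<in> {x, z, w}" for y
      using that z by (auto simp: mul_lc_left mul_lc_right)
    have C: "basis3 (lc x z w (1 - t) 0 k) (lc x z w (1 + t) 0 (- k)) (lc x z w 0 2 0)"
      unfolding basis3_def lc_nested
    proof (intro allI impI)
      fix f g h assume "lc x z w (f * (1 - t) + g * (1 + t) + h * 0) (f * 0 + g * 0 + h * 2) (f * k + g * - k + h * 0) = 0"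
      then have h: "h = 0" and 1: "f * (1 - t) + g * (1 + t) = 0" and "f * k = g * k"
        by (auto simp: lc_eq_0_iff[OF B])
      then have "f = g" using k(2) by simp
      with 1 have "2 * f = 0" by (simp add: algebra_simps)
      with h \<open>f = g\<close> show "f = 0 \<and> g = 0 \<and> h = 0" by simp
    qed
    show ?thesis
    proof (cases "t = 0")
      case True
      show ?thesis
        by (rule listedI[where X = A05, OF C _ refl])
          (simp_all add: e zz mul_lc_left[of x z w 0 2 0] mul_lc_right[of _ x z w 0 2 0] z,
            simp_all add: S True)
    next
      case False
      \<comment> \<open>With third basis vector \<open>2 z\<close> the two mixed products have
        coefficients 1 - t and 1 + t, whence the sign of the parameter.\<close>
      show ?thesis
        by (rule listedI[where X = "R02 (- t)", OF C _ refl])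
          (simp_all add: e zz mul_lc_left[of x z w 0 2 0] mul_lc_right[of _ x z w 0 2 0] z,
            simp_all add: S False)
    qed
  qed
qed

text \<open>Zero squares make the product anticommutative, and (uv)v = u(vv) = 0, likewise (vu)u =
  0, so \<open>uv\<close> is annihilated by both factors. Multiplying a relation by \<open>v\<close>
  and by \<open>u\<close> then gives independence.\<close>

lemma listed_zero_squares:
  assumes sq: "\<And>x. mul x x = 0" and nz: "mul u v \<noteq> 0"
  shows listed
proof -
  have anti: "mul y x = - mul x y" for x y
  proof -
    have "mul (x + y) (x + y) = mul x x + mul y y + (mul y x + mul x y)"
      unfolding mul_add_left mul_add_right by (simp add: add_ac)
    then show ?thesis by (simp add: sq eq_neg_iff_add_eq_0)
  qed
  define w where "w = mul u v"
  have vu: "mul v u = - w" by (simp add: w_def anti[of u v])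
  have wv: "mul w v = 0" and vw: "mul v w = 0"
    using right_alt_square[of u v] anti[of w v] by (simp_all add: sq w_def)
  have wu: "mul w u = 0" and uw: "mul u w = 0"
    using right_alt_square[of v u] anti[of v u] anti[of w u] by (simp_all add: sq w_def mul_minus_left)
  have B: "basis3 u v w"
    unfolding basis3_def
  proof (intro allI impI)
    fix a b c assume z: "lc u v w a b c = 0"
    have "scl a w = mul (lc u v w a b c) v" "scl b w = mul u (lc u v w a b c)"
      by (simp_all add: mul_lc_left mul_lc_right sq wv uw flip: w_def)
    then have "a = 0" "b = 0" using z nz by (auto simp: w_def)
    then show "a = 0 \<and> b = 0 \<and> c = 0" using z nz by (simp add: lc_def w_def)
  qed
  show ?thesis
    by (rule listedI[where X = R00, OF B _ refl])
      (simp_all add: table_simps sq wv vw wu uw vu flip: w_def, simp_all add: lc_def)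
qed

lemma mul_ev_monom: "mul (ev x (monom 1 i)) (ev x (monom 1 j)) = ev x (monom 1 (i + j + 1))"
  by (simp add: mul_ev_ev mult_monom monom_Suc)

lemma listed_cube_nonzero:
  assumes nil: "nilpotent x" and cube: "mul (mul x x) x \<noteq> 0"
  shows listed
proof -
  \<comment> \<open>Here \<open>m i\<close> is the power with exponent \<open>i + 1\<close>, which
    explains the index \<open>i + j + 1\<close> of a product.\<close>
  define m where "m i = ev x (monom 1 i)" for i
  have m: "mul (m i) (m j) = m (i + j + 1)" for i j by (simp only: m_def mul_ev_monom)
  have m012: "m 0 = x" "m 1 = mul x x" "m 2 = mul (mul x x) x" by (simp_all only: m_def ev_monom_small)
  have B: "basis3 (m 0) (m 1) (m 2)" using nilpotent_cube_basis(1)[OF nil cube] by (simp only: m012)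
  have m3: "ev x (monom 1 3) = 0" using nilpotent_cube_basis(2)[OF nil cube] by (simp only: ev_monom_small)
  have z: "m k = 0" if "3 \<le> k" for k
    unfolding m_def using that by (intro ev_dvd[OF m3]) (simp add: monom_altdef le_imp_power_dvd)
  show ?thesis
    by (rule listedI[where X = A06, OF B _ refl]) (simp_all add: m table_simps z lc_def eval_nat_numeral)
qed

text \<open>The cube of right multiplication by \<open>x\<close> is right multiplication by the cube
  of \<open>x\<close>.\<close>

lemma mul_right_cube: "mul (mul x x) x = 0 \<Longrightarrow> mul (mul (mul y x) x) x = 0"
  using mul_ev_commute(2)[of y x "monom 1 1"] ev_monom_small(2)[of x] by (simp add: right_alt_square)

text \<open>All right multiplications have cube zero here. Together with the linearized cube
  identity this makes \<open>z = xx\<close> annihilate everything and all products multiples of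
  \<open>z\<close>.\<close>

lemma listed_cubes_zero:
  assumes nil: "nilpotent x" and cube: "\<And>y. mul (mul y y) y = 0" and sq: "mul x x \<noteq> 0"
  shows listed
proof -
  define z where "z = mul x x"
  have zx: "mul z x = 0" and xz: "mul x z = 0" and zz: "mul z z = 0"
    using cube[of x] right_alt_square[of x x] right_alt_square[of z x] by (simp_all add: z_def)
  have ind: "a = 0 \<and> b = 0" if "scl a x + scl b z = 0" for a b
    using nilpotent_square_independent[OF nil sq] that by (auto simp: z_def)
  have "x \<noteq> 0" using sq by auto
  then obtain u v where U: "basis3 x u v" using extend_basis3[of UNIV x] by auto
  obtain a b c where zabc: "z = lc x u v a b c" using basis3_span[OF U] by blast
  have bc: "b \<noteq> 0 \<or> c \<noteq> 0"
    using ind[of "- a" 1] by (auto simp: zabc lc_def)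
  have "\<exists>w. basis3 x z w"
  proof (cases "b = 0")
    case True
    have "basis3 (lc x u v 1 0 0) z (lc x u v 0 1 0)"
      unfolding basis3_def zabc lc_nested using True bc by (auto simp: lc_eq_0_iff[OF U])
    then show ?thesis by (auto simp: lc_unit)
  next
    case False
    have "basis3 (lc x u v 1 0 0) z (lc x u v 0 0 1)"
      unfolding basis3_def zabc lc_nested using False by (auto simp: lc_eq_0_iff[OF U])
    then show ?thesis by (auto simp: lc_unit)
  qed
  then obtain w0 where W: "basis3 x z w0" by blast
  obtain al be ga where w0x: "mul w0 x = lc x z w0 al be ga" using basis3_span[OF W] by blast
  have xx: "mul x x = lc x z w0 0 1 0" by (simp add: z_def lc_unit)
  \<comment> \<open>Right multiplication by \<open>x\<close> maps the span of \<open>x\<close>,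
    \<open>z\<close> into itself and acts on the quotient by \<open>ga\<close>; since it is
    nilpotent, \<open>ga = 0\<close>.\<close>
  have ga: "ga = 0"
    using mul_right_cube[OF cube, of w0 x]
    by (simp add: w0x xx zx lc_simps lc_eq_0_iff[OF W])
  define w where "w = w0 - scl be x"
  have wx': "mul w x = scl al x"
    by (simp add: w_def mul_diff_left mul_scale_left w0x ga) (simp add: lc_def z_def)
  have B: "basis3 x z w"
    unfolding basis3_def
  proof (intro allI impI)
    fix k l m assume "lc x z w k l m = 0"
    then have "lc x z w0 (k - m * be) l m = 0"
      by (simp add: lc_def w_def scale_right_diff_distrib scale_left_diff_distrib algebra_simps)
    then show "k = 0 \<and> l = 0 \<and> m = 0" by (auto simp: lc_eq_0_iff[OF W])
  qed
  have xx: "mul x x = lc x z w 0 1 0" and wx: "mul w x = lc x z w al 0 0"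
    by (simp add: z_def lc_unit, simp add: wx' lc_def)
  obtain a b c where xw: "mul x w = lc x z w a b c" using basis3_span[OF B] by blast
  obtain d1 d2 d3 where zw: "mul z w = lc x z w d1 d2 d3" using basis3_span[OF B] by blast
  obtain r s t where ww: "mul w w = lc x z w r s t" using basis3_span[OF B] by blast
  have wz: "mul w z = lc x z w 0 al 0"
    using right_alt_square[of w x] by (simp add: wx' mul_scale_left flip: z_def) (simp add: lc_def)
  note S = xx wx xw zw ww wz zx xz zz lc_simps lc_eq_iff[OF B] lc_eq_0_iff[OF B]
  \<comment> \<open>The part of the cube of \<open>x + w\<close> that is odd in \<open>w\<close>;
    since all cubes vanish, this yields the identity of degree one in \<open>w\<close>.\<close>
  have "scl 2 (mul z w + mul (mul x w) x + mul (mul w x) x + mul (mul w w) w) =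
      mul (mul (x + w) (x + w)) (x + w) - mul (mul (x - w) (x - w)) (x - w)"
    by (simp add: z_def mul_add_left mul_add_right mul_diff_left mul_diff_right
        scale_left_distrib[of 1 1, simplified] algebra_simps)
  then have "mul z w + mul (mul x w) x + mul (mul w x) x = 0"
    by (simp add: cube)
  then have E2: "d1 + c * al = 0 \<and> d2 + a + al = 0 \<and> d3 = 0" by (simp add: S)
  have "mul (mul x x) w + mul (mul x w) x = mul x (mul x w) + mul x (mul w x)"
    by (rule right_alt_linearized)
  then have E1: "d1 + c * al = c * a \<and> d2 + a = a + c * b + al \<and> d3 = c * c"
    by (simp add: S)
  have c: "c = 0" using E1 E2 by simp
  have d: "d1 = 0" "d3 = 0" "d2 = al" "a = - 2 * al" using E1 E2 c by (auto simp: eq_neg_iff_add_eq_0 add.commute)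
  \<comment> \<open>By now right multiplication by \<open>w\<close> is triangular on the span of
    \<open>x\<close>, \<open>z\<close> with eigenvalues \<open>- 2 al\<close> and \<open>al\<close>,
    and its cube is 0.\<close>
  have al: "al = 0"
    using mul_right_cube[OF cube, of x w] c d by (auto simp: S)
  have "t = 0" using cube[of w] c d al by (auto simp: S)
  moreover have "r = 0" using right_alt_square[of x w] c d al calculation by (auto simp: S)
  ultimately have "mul w w = scl s z" "mul x w = scl b z" "mul w x = 0" "mul z w = 0" "mul w z = 0"
    using c d al by (simp_all add: S) (simp_all add: lc_def)
  then show ?thesis
    using zz zx xz by (intro listed_annihilating_form[OF B z_def[symmetric]])
qed

lemma listed_nonzero:
  assumes nz: "mul x0 y0 \<noteq> 0"
  shows listed
proof (cases "\<forall>x. nilpotent x")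
  case True
  then show ?thesis
    using listed_cube_nonzero listed_cubes_zero listed_zero_squares nz by metis
next
  case False
  then show ?thesis using idempotent_of_not_nilpotent listed_of_idempotent by metis
qed

end

theorem theoremA1:
  fixes scl :: "complex \<Rightarrow> 'a::ab_group_add \<Rightarrow> 'a"
    and mul :: "'a \<Rightarrow> 'a \<Rightarrow> 'a"
  shows "(complex_algebra scl mul \<and> vector_space.dim scl (UNIV :: 'a set) = 3
            \<and> right_alternative mul \<and> (\<exists>x y. mul x y \<noteq> 0)
          \<longrightarrow> (commutative mul \<and> (\<exists>X\<in>A_list. algebra_isomorphic scl mul (*s) (alg_mult X)))
              \<or> (\<exists>X\<in>R_list. algebra_isomorphic scl mul (*s) (alg_mult X)))
       \<and> (\<forall>X\<in>A_list. commutative (alg_mult X) \<and> associative (alg_mult X))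
       \<and> (\<forall>X\<in>A_list \<union> R_list. \<forall>Y\<in>A_list \<union> R_list.
            algebra_isomorphic (*s) (alg_mult X) (*s) (alg_mult Y)
              \<longleftrightarrow> X = Y \<or> (\<exists>\<alpha>. X = R02 \<alpha> \<and> Y = R02 (- \<alpha>)))"
proof (intro conjI impI ballI)
  assume asm: "complex_algebra scl mul \<and> vector_space.dim scl (UNIV :: 'a set) = 3
    \<and> right_alternative mul \<and> (\<exists>x y. mul x y \<noteq> 0)"
  then interpret complex_algebra scl mul by blast
  interpret right_alternative_algebra3 scl mul
    using asm by unfold_locales auto
  obtain X where X: "X \<in> A_list \<union> R_list" "algebra_isomorphic scl mul (*s) (alg_mult X)"
    using asm listed_nonzero unfolding listed_def by blast
  show "(commutative mul \<and> (\<exists>X\<in>A_list. algebra_isomorphic scl mul (*s) (alg_mult X)))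
      \<or> (\<exists>X\<in>R_list. algebra_isomorphic scl mul (*s) (alg_mult X))"
  proof (cases "X \<in> A_list")
    case True
    then have "commutative (alg_mult X)" by (auto simp: A_list_def commutative_alg)
    then show ?thesis using True X(2) isomorphic_invariants(1)[OF X(2)] by blast
  qed (use X in blast)
next
  fix X assume "X \<in> A_list"
  then show "commutative (alg_mult X)" "associative (alg_mult X)"
    by (auto simp: A_list_def commutative_alg associative_alg)
next
  fix X Y assume "X \<in> A_list \<union> R_list" "Y \<in> A_list \<union> R_list"
  then show "algebra_isomorphic (*s) (alg_mult X) (*s) (alg_mult Y)
      \<longleftrightarrow> X = Y \<or> (\<exists>\<alpha>. X = R02 \<alpha> \<and> Y = R02 (- \<alpha>))"
    by (rule alg_isomorphic_iff)
qed

end
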